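(* Let $q,r\in\mathbb{C}$ with $qr\neq 0$, and let $\mathcal{A}_{q,r}$ be the unital associative $\mathbb{C}$-algebra generated by $e_1,e_2$ with relations $$e_2e_1^2+qr\,e_1^2e_2-(q+r)\,e_1e_2e_1=0,\qquad e_2^2e_1+qr\,e_1e_2^2-(q+r)\,e_2e_1e_2=0.$$ Set $p=q/r^2$. Then the quantum group $GL_{p,q}(2)$ acts on $\mathcal{A}_{q,r}$; that is, the assignment $$e_1\mapsto a\otimes e_1+b\otimes e_2,\qquad e_2\mapsto c\otimes e_1+d\otimes e_2$$ extends to an algebra homomorphism $\mathcal{A}_{q,r}\to \mathcal{O}(GL_{p,q}(2))\otimes\mathcal{A}_{q,r}$ which is a coaction of the Hopf algebra $\mathcal{O}(GL_{p,q}(2))$ on $\mathcal{A}_{q,r}$. Since $\mathcal{A}_{q,r}=\mathcal{A}_{r,q}$, the quantum group $GL_{r/q^2,\,r}(2)$ also acts on $\mathcal{A}_{q,r}$ in the same way.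
   Context: An action of the quantum group $GL_{p,q}(2)$ means a coaction of the corresponding Hopf algebra. For nonzero $p,q\in\mathbb{C}$, the Hopf algebra $\mathcal{O}(GL_{p,q}(2))$ is generated by $a,b,c,d$ and the inverse $\mathcal{D}^{-1}$ of the quantum determinant $\mathcal{D}=ad-q^{-1}cb=ad-p^{-1}bc$, with relations $$ab=p^{-1}ba,\quad cd=p^{-1}dc,\quad ac=q^{-1}ca,\quad bd=q^{-1}db,\quad q\,bc=p\,cb,\quad ad-q^{-1}cb=da-q\,bc,$$ and $\mathcal{D}\mathcal{D}^{-1}=\mathcal{D}^{-1}\mathcal{D}=1$. The coproduct and counit are determined by matrix comultiplication on $\begin{pmatrix}a&b\\c&d\end{pmatrix}$ (i.e. $\Delta t_{ij}=\sum_k t_{ik}\otimes t_{kj}$, $\varepsilon(t_{ij})=\delta_{ij}$). The convention is such that $GL_{q,q}(2)=GL_q(2)$ and $GL_{1,1}(2)=GL(2)$. For $qr\neq 0$, $\mathcal{A}_{q,r}$ is the generic cubic Artin–Schelter regular algebra of type $S_1$; $\mathcal{A}_{1,1}$ is the parafermionic algebra for $D=2$, i.e. the algebra generated by $e_1,e_2$ with relations $[e_k,[e_\ell,e_m]]=0$ for all $k,\ell,m\in\{1,2\}$, on which $GL(2)$ acts naturally by linear substitutions of the generators. *)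

theory Defs
  imports Complex_Main "HOL-Algebra.QuotRing" "HOL-Algebra.Module" "HOL-Library.Poly_Mapping"
begin

section \<open>Unital associative algebras over the complex numbers\<close>

text \<open>The complex numbers, both as base ring and as one-dimensional algebra.\<close>

definition complex_alg :: "(complex, complex) module" where
  "complex_alg = \<lparr>carrier = UNIV, mult = (*), one = 1, zero = 0, add = (+), smult = (*)\<rparr>"

text \<open>The library locale \<^locale>\<open>algebra\<close> requires commutativity.\<close>

locale complex_algebra = module complex_alg A + ring A for A (structure) +
  assumes smult_mult_left:
      "\<lbrakk>x \<in> carrier A; y \<in> carrier A\<rbrakk> \<Longrightarrow> (s \<odot> x) \<otimes> y = s \<odot> (x \<otimes> y)"
    and smult_mult_right:
      "\<lbrakk>x \<in> carrier A; y \<in> carrier A\<rbrakk> \<Longrightarrow> x \<otimes> (s \<odot> y) = s \<odot> (x \<otimes> y)"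

definition lin_hom ::
  "(complex, 'a, 'm) module_scheme \<Rightarrow> (complex, 'b, 'n) module_scheme \<Rightarrow> ('a \<Rightarrow> 'b) set" where
  "lin_hom M N = {f \<in> carrier M \<rightarrow> carrier N.
     (\<forall>x\<in>carrier M. \<forall>y\<in>carrier M. f (x \<oplus>\<^bsub>M\<^esub> y) = f x \<oplus>\<^bsub>N\<^esub> f y) \<and>
     (\<forall>s. \<forall>x\<in>carrier M. f (s \<odot>\<^bsub>M\<^esub> x) = s \<odot>\<^bsub>N\<^esub> f x)}"

definition alg_hom ::
  "(complex, 'a, 'm) module_scheme \<Rightarrow> (complex, 'b, 'n) module_scheme \<Rightarrow> ('a \<Rightarrow> 'b) set" where
  "alg_hom A B = ring_hom A B \<inter> lin_hom A B"

text \<open>The monoid algebra: formal linear combinations of elements of a monoid.\<close>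

definition monoid_alg :: "('m, 'x) monoid_scheme \<Rightarrow> (complex, 'm \<Rightarrow>\<^sub>0 complex) module" where
  "monoid_alg G =
    \<lparr>carrier = {f. Poly_Mapping.keys f \<subseteq> carrier G},
     mult = (\<lambda>f g. \<Sum>x\<in>Poly_Mapping.keys f. \<Sum>y\<in>Poly_Mapping.keys g.
       Poly_Mapping.single (x \<otimes>\<^bsub>G\<^esub> y) (Poly_Mapping.lookup f x * Poly_Mapping.lookup g y)),
     one = Poly_Mapping.single \<one>\<^bsub>G\<^esub> 1,
     zero = 0,
     add = (+),
     smult = (\<lambda>s. Poly_Mapping.map (\<lambda>z. s * z))\<rparr>"

text \<open>The scalar multiplication on cosets follows the pattern of \<^const>\<open>rcoset_mult\<close>.\<close>

definition quot_alg :: "(complex, 'a, 'm) module_scheme \<Rightarrow> 'a set \<Rightarrow> (complex, 'a set) module" where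
  "quot_alg A I =
    \<lparr>carrier = carrier (A Quot I), mult = mult (A Quot I), one = one (A Quot I),
     zero = zero (A Quot I), add = add (A Quot I),
     smult = (\<lambda>s X. \<Union>x\<in>X. I +>\<^bsub>A\<^esub> (s \<odot>\<^bsub>A\<^esub> x))\<rparr>"

text \<open>
  If \<open>X\<close> is a coset of formal linear combinations on which the linear extension of \<open>\<phi>\<close>
  is constant, \<open>coset_ext P \<phi> X\<close> is that constant value.
\<close>

definition lin_ext ::
  "(complex, 'b, 'n) module_scheme \<Rightarrow> ('k \<Rightarrow> 'b) \<Rightarrow> ('k \<Rightarrow>\<^sub>0 complex) \<Rightarrow> 'b" where
  "lin_ext P \<phi> f = (\<Oplus>\<^bsub>P\<^esub>k\<in>Poly_Mapping.keys f. Poly_Mapping.lookup f k \<odot>\<^bsub>P\<^esub> \<phi> k)"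

definition coset_ext ::
  "(complex, 'b, 'n) module_scheme \<Rightarrow> ('k \<Rightarrow> 'b) \<Rightarrow> ('k \<Rightarrow>\<^sub>0 complex) set \<Rightarrow> 'b" where
  "coset_ext P \<phi> X = the_elem (lin_ext P \<phi> ` X)"


section \<open>Algebras given by generators and relations\<close>

definition free_monoid :: "'g list monoid" where
  "free_monoid = \<lparr>carrier = UNIV, mult = (@), one = []\<rparr>"

definition free_alg :: "(complex, 'g list \<Rightarrow>\<^sub>0 complex) module" where
  "free_alg = monoid_alg free_monoid"

definition pres_alg ::
  "('g list \<Rightarrow>\<^sub>0 complex) set \<Rightarrow> (complex, ('g list \<Rightarrow>\<^sub>0 complex) set) module" where
  "pres_alg Rels = quot_alg free_alg (Idl\<^bsub>free_alg\<^esub> Rels)"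

definition pres_gen :: "('g list \<Rightarrow>\<^sub>0 complex) set \<Rightarrow> 'g \<Rightarrow> ('g list \<Rightarrow>\<^sub>0 complex) set" where
  "pres_gen Rels g = (Idl\<^bsub>free_alg\<^esub> Rels) +>\<^bsub>free_alg\<^esub> Poly_Mapping.single [g] 1"

text \<open>
  The algebra homomorphism from a presented algebra to \<open>B\<close> with prescribed values on the
  generators; meaningful when these values satisfy the relations.
\<close>

definition pres_lift ::
  "(complex, 'b, 'n) module_scheme \<Rightarrow> ('g \<Rightarrow> 'b) \<Rightarrow> ('g list \<Rightarrow>\<^sub>0 complex) set \<Rightarrow> 'b" where
  "pres_lift B v = coset_ext B (\<lambda>w. foldr (\<lambda>g z. v g \<otimes>\<^bsub>B\<^esub> z) w \<one>\<^bsub>B\<^esub>)"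


section \<open>Tensor products of algebras\<close>

definition lin_span :: "(complex, 'a, 'm) module_scheme \<Rightarrow> 'a set \<Rightarrow> 'a set" where
  "lin_span M S = \<Inter>{N. submodule N complex_alg M \<and> S \<subseteq> N}"

definition bilinear_rels ::
  "(complex, 'a, 'm) module_scheme \<Rightarrow> (complex, 'b, 'n) module_scheme \<Rightarrow> ('a \<times> 'b \<Rightarrow>\<^sub>0 complex) set"
where
  "bilinear_rels A B =
     {Poly_Mapping.single (x \<oplus>\<^bsub>A\<^esub> x', y) 1 - Poly_Mapping.single (x, y) 1
        - Poly_Mapping.single (x', y) 1
       | x x' y. x \<in> carrier A \<and> x' \<in> carrier A \<and> y \<in> carrier B} \<union>
     {Poly_Mapping.single (x, y \<oplus>\<^bsub>B\<^esub> y') 1 - Poly_Mapping.single (x, y) 1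
        - Poly_Mapping.single (x, y') 1
       | x y y'. x \<in> carrier A \<and> y \<in> carrier B \<and> y' \<in> carrier B} \<union>
     {Poly_Mapping.single (s \<odot>\<^bsub>A\<^esub> x, y) 1 - Poly_Mapping.single (x, y) s
       | s x y. x \<in> carrier A \<and> y \<in> carrier B} \<union>
     {Poly_Mapping.single (x, s \<odot>\<^bsub>B\<^esub> y) 1 - Poly_Mapping.single (x, y) s
       | s x y. x \<in> carrier A \<and> y \<in> carrier B}"

text \<open>
  The free vector space on \<open>carrier A \<times> carrier B\<close> modulo bilinearity.  It is written as a monoid
  algebra over the product of the multiplicative monoids so that the quotient carries the product
  \<open>(x \<otimes> y) (x' \<otimes> y') = x x' \<otimes> y y'\<close>; the span of the bilinearity relations is a two-sided ideal
  because products of relations with basis elements are again relations.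
\<close>

definition tensor_rels ::
  "(complex, 'a, 'm) module_scheme \<Rightarrow> (complex, 'b, 'n) module_scheme \<Rightarrow> ('a \<times> 'b \<Rightarrow>\<^sub>0 complex) set"
where
  "tensor_rels A B = lin_span (monoid_alg (A \<times>\<times> B)) (bilinear_rels A B)"

definition tensor_alg ::
  "(complex, 'a, 'm) module_scheme \<Rightarrow> (complex, 'b, 'n) module_scheme
    \<Rightarrow> (complex, ('a \<times> 'b \<Rightarrow>\<^sub>0 complex) set) module" where
  "tensor_alg A B = quot_alg (monoid_alg (A \<times>\<times> B)) (tensor_rels A B)"

definition tensor ::
  "(complex, 'a, 'm) module_scheme \<Rightarrow> (complex, 'b, 'n) module_scheme
    \<Rightarrow> 'a \<Rightarrow> 'b \<Rightarrow> ('a \<times> 'b \<Rightarrow>\<^sub>0 complex) set" where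
  "tensor A B x y = tensor_rels A B +>\<^bsub>monoid_alg (A \<times>\<times> B)\<^esub> Poly_Mapping.single (x, y) 1"

text \<open>The linear map on a tensor product induced by a bilinear map \<open>\<beta>\<close> with values in \<open>P\<close>.\<close>

definition tensor_lift ::
  "(complex, 'c, 'n) module_scheme \<Rightarrow> ('a \<Rightarrow> 'b \<Rightarrow> 'c) \<Rightarrow> ('a \<times> 'b \<Rightarrow>\<^sub>0 complex) set \<Rightarrow> 'c" where
  "tensor_lift P \<beta> = coset_ext P (\<lambda>(x, y). \<beta> x y)"

text \<open>\<open>f \<otimes> g\<close> for linear maps \<open>f\<close> into \<open>A\<close> and \<open>g\<close> into \<open>B\<close>.\<close>

definition tensor_map ::
  "(complex, 'c, 'm) module_scheme \<Rightarrow> (complex, 'd, 'n) module_scheme \<Rightarrow> ('a \<Rightarrow> 'c) \<Rightarrow> ('b \<Rightarrow> 'd)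
    \<Rightarrow> ('a \<times> 'b \<Rightarrow>\<^sub>0 complex) set \<Rightarrow> ('c \<times> 'd \<Rightarrow>\<^sub>0 complex) set" where
  "tensor_map A B f g = tensor_lift (tensor_alg A B) (\<lambda>x y. tensor A B (f x) (g y))"

text \<open>The canonical isomorphism \<open>(A \<otimes> B) \<otimes> C \<rightarrow> A \<otimes> (B \<otimes> C)\<close>.\<close>

definition tensor_assoc ::
  "(complex, 'a, 'l) module_scheme \<Rightarrow> (complex, 'b, 'm) module_scheme
    \<Rightarrow> (complex, 'c, 'n) module_scheme
    \<Rightarrow> (('a \<times> 'b \<Rightarrow>\<^sub>0 complex) set \<times> 'c \<Rightarrow>\<^sub>0 complex) set
    \<Rightarrow> ('a \<times> ('b \<times> 'c \<Rightarrow>\<^sub>0 complex) set \<Rightarrow>\<^sub>0 complex) set" where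
  "tensor_assoc A B C =
     tensor_lift (tensor_alg A (tensor_alg B C))
       (\<lambda>t z. tensor_lift (tensor_alg A (tensor_alg B C))
          (\<lambda>x y. tensor A (tensor_alg B C) x (tensor B C y z)) t)"


section \<open>Hopf algebras and their coactions on algebras\<close>

locale hopf_algebra = complex_algebra H for H (structure) +
  fixes \<Delta> :: "'h \<Rightarrow> ('h \<times> 'h \<Rightarrow>\<^sub>0 complex) set" and \<epsilon> :: "'h \<Rightarrow> complex"
  assumes comult_hom: "\<Delta> \<in> alg_hom H (tensor_alg H H)"
    and counit_hom: "\<epsilon> \<in> alg_hom H complex_alg"
    and coassoc: "x \<in> carrier H \<Longrightarrow>
      tensor_assoc H H H (tensor_map (tensor_alg H H) H \<Delta> (\<lambda>y. y) (\<Delta> x))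
        = tensor_map H (tensor_alg H H) (\<lambda>y. y) \<Delta> (\<Delta> x)"
    and counit_left: "x \<in> carrier H \<Longrightarrow> tensor_lift H (\<lambda>y z. \<epsilon> y \<odot> z) (\<Delta> x) = x"
    and counit_right: "x \<in> carrier H \<Longrightarrow> tensor_lift H (\<lambda>y z. \<epsilon> z \<odot> y) (\<Delta> x) = x"
    and antipode: "\<exists>S\<in>lin_hom H H. \<forall>x\<in>carrier H.
      tensor_lift H (\<lambda>y z. S y \<otimes> z) (\<Delta> x) = \<epsilon> x \<odot> \<one> \<and>
      tensor_lift H (\<lambda>y z. y \<otimes> S z) (\<Delta> x) = \<epsilon> x \<odot> \<one>"

text \<open>A left coaction of a Hopf algebra \<open>H\<close> on an algebra \<open>A\<close> by algebra homomorphisms.\<close>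

locale hopf_coaction = hopf_algebra H \<Delta> \<epsilon> + A: complex_algebra A
  for H :: "(complex, 'h, 'm) module_scheme" (structure) and \<Delta> and \<epsilon>
    and A :: "(complex, 'a, 'n) module_scheme" +
  fixes \<delta> :: "'a \<Rightarrow> ('h \<times> 'a \<Rightarrow>\<^sub>0 complex) set"
  assumes coaction_hom: "\<delta> \<in> alg_hom A (tensor_alg H A)"
    and coaction_coassoc: "x \<in> carrier A \<Longrightarrow>
      tensor_assoc H H A (tensor_map (tensor_alg H H) A \<Delta> (\<lambda>y. y) (\<delta> x))
        = tensor_map H (tensor_alg H A) (\<lambda>y. y) \<delta> (\<delta> x)"
    and coaction_counit: "x \<in> carrier A \<Longrightarrow> tensor_lift A (\<lambda>h y. \<epsilon> h \<odot>\<^bsub>A\<^esub> y) (\<delta> x) = x"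


section \<open>The quantum group \<open>GL\<^sub>p\<^sub>,\<^sub>q(2)\<close>\<close>

text \<open>\<open>Ga, Gb, Gc, Gd\<close> are the matrix entries, \<open>Gi\<close> is the inverse of the quantum determinant.\<close>

datatype gl_gen = Ga | Gb | Gc | Gd | Gi

definition GL_rels :: "complex \<Rightarrow> complex \<Rightarrow> (gl_gen list \<Rightarrow>\<^sub>0 complex) set" where
  "GL_rels p q = (let m = Poly_Mapping.single in
    {m [Ga, Gb] 1 - m [Gb, Ga] (inverse p),
     m [Gc, Gd] 1 - m [Gd, Gc] (inverse p),
     m [Ga, Gc] 1 - m [Gc, Ga] (inverse q),
     m [Gb, Gd] 1 - m [Gd, Gb] (inverse q),
     m [Gb, Gc] q - m [Gc, Gb] p,
     (m [Ga, Gd] 1 - m [Gc, Gb] (inverse q)) - (m [Gd, Ga] 1 - m [Gb, Gc] q),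
     (m [Ga, Gd, Gi] 1 - m [Gc, Gb, Gi] (inverse q)) - m [] 1,
     (m [Gi, Ga, Gd] 1 - m [Gi, Gc, Gb] (inverse q)) - m [] 1})"

definition GL_alg :: "complex \<Rightarrow> complex \<Rightarrow> (complex, (gl_gen list \<Rightarrow>\<^sub>0 complex) set) module" where
  "GL_alg p q = pres_alg (GL_rels p q)"

definition GL_gen :: "complex \<Rightarrow> complex \<Rightarrow> gl_gen \<Rightarrow> (gl_gen list \<Rightarrow>\<^sub>0 complex) set" where
  "GL_gen p q = pres_gen (GL_rels p q)"

text \<open>
  Matrix comultiplication makes the quantum determinant group-like, which forces the value of
  the comultiplication on its inverse.
\<close>

definition GL_comult ::
  "complex \<Rightarrow> complex \<Rightarrow> (gl_gen list \<Rightarrow>\<^sub>0 complex) set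
    \<Rightarrow> ((gl_gen list \<Rightarrow>\<^sub>0 complex) set \<times> (gl_gen list \<Rightarrow>\<^sub>0 complex) set \<Rightarrow>\<^sub>0 complex) set" where
  "GL_comult p q =
     (let H = GL_alg p q; T = tensor_alg H H;
          t = (\<lambda>g h. tensor H H (GL_gen p q g) (GL_gen p q h))
      in pres_lift T (\<lambda>g. case g of
           Ga \<Rightarrow> t Ga Ga \<oplus>\<^bsub>T\<^esub> t Gb Gc
         | Gb \<Rightarrow> t Ga Gb \<oplus>\<^bsub>T\<^esub> t Gb Gd
         | Gc \<Rightarrow> t Gc Ga \<oplus>\<^bsub>T\<^esub> t Gd Gc
         | Gd \<Rightarrow> t Gc Gb \<oplus>\<^bsub>T\<^esub> t Gd Gd
         | Gi \<Rightarrow> t Gi Gi))"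

text \<open>The counit does not depend on \<open>p, q\<close> as a function of representatives.\<close>

definition GL_counit :: "(gl_gen list \<Rightarrow>\<^sub>0 complex) set \<Rightarrow> complex" where
  "GL_counit = pres_lift complex_alg
     (\<lambda>g. case g of Ga \<Rightarrow> 1 | Gb \<Rightarrow> 0 | Gc \<Rightarrow> 0 | Gd \<Rightarrow> 1 | Gi \<Rightarrow> 1)"

text \<open>The quantum group acts on \<open>A\<close>, by linear substitutions of the elements \<open>x\<^sub>1\<close> and \<open>x\<^sub>2\<close>.\<close>

definition GL_acts ::
  "complex \<Rightarrow> complex \<Rightarrow> (complex, 'a, 'n) module_scheme \<Rightarrow> 'a \<Rightarrow> 'a \<Rightarrow> bool" where
  "GL_acts p q A x\<^sub>1 x\<^sub>2 \<longleftrightarrow>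
     (let H = GL_alg p q; T = tensor_alg H A; t = (\<lambda>g. tensor H A (GL_gen p q g))
      in \<exists>\<delta>. hopf_coaction H (GL_comult p q) GL_counit A \<delta> \<and>
           \<delta> x\<^sub>1 = t Ga x\<^sub>1 \<oplus>\<^bsub>T\<^esub> t Gb x\<^sub>2 \<and>
           \<delta> x\<^sub>2 = t Gc x\<^sub>1 \<oplus>\<^bsub>T\<^esub> t Gd x\<^sub>2)"


section \<open>The cubic Artin-Schelter regular algebras of type \<open>S\<^sub>1\<close>\<close>

datatype as_gen = E1 | E2

definition AS_rels :: "complex \<Rightarrow> complex \<Rightarrow> (as_gen list \<Rightarrow>\<^sub>0 complex) set" where
  "AS_rels q r = (let m = Poly_Mapping.single in
    {m [E2, E1, E1] 1 + m [E1, E1, E2] (q * r) - m [E1, E2, E1] (q + r),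
     m [E2, E2, E1] 1 + m [E1, E2, E2] (q * r) - m [E2, E1, E2] (q + r)})"

definition AS_alg :: "complex \<Rightarrow> complex \<Rightarrow> (complex, (as_gen list \<Rightarrow>\<^sub>0 complex) set) module" where
  "AS_alg q r = pres_alg (AS_rels q r)"

definition AS_gen :: "complex \<Rightarrow> complex \<Rightarrow> as_gen \<Rightarrow> (as_gen list \<Rightarrow>\<^sub>0 complex) set" where
  "AS_gen q r = pres_gen (AS_rels q r)"

end

(*
  Let X = e2 e1 - q e1 e2. The two relations say X e1 = r e1 X and e2 X = r X e2. The
  substitution by the matrix entries sends X to D (x) X, where D is the quantum determinant, and D
  commutes with a and d while D b = (q/p) b D and c D = (q/p) D c. So the relations are
  preserved exactly because q/p = r^2.

  The generators of O(GL_{p,q}(2)) are ordered a < b < c < d < D^{-1}; the relations rewrite every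
  product of generators into ordered monomials. Since linear functionals separate the points of
  a complex algebra, an identity between such expressions becomes an identity of complex numbers,
  linear in the values of the functional on ordered monomials. The antipode is an algebra
  homomorphism into the opposite algebra, sending the matrix of generators to its inverse.
*)

theory Submission
  imports Defs
begin

section \<open>Complex algebras and linear functionals\<close>

text \<open>The organising principle is the functor of points: a \<open>GL_tuple\<close> in an
  algebra is the same thing as an algebra homomorphism out of O(GL_{p,q}(2)). Comultiplication,
  counit and antipode then arise from matrix multiplication, the identity matrix and matrix
  inversion, where inversion reverses products and so lands in the opposite algebra. The ordering
  rules serve as valid rewrites: two expressions with the same sorted form are equal. The practical
  obstacle is that scalars such as q - 1/p stand in front of noncommuting words of a carrier-based
  algebra and must be compared up to division. A functional turns every sorted word into an opaque
  complex number, so that field arithmetic can finish. All Hopf and coaction axioms except the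
  antipode equate two algebra homomorphisms and are therefore checked on generators. The antipode
  identities involve convolutions, which are not multiplicative, and need an induction of their own.
  That the cubic relations are preserved is verified by sorting all words of degree three; the
  element X explains why that calculation closes.\<close>

lemma complex_alg_simps [simp]:
  "carrier complex_alg = UNIV" "mult complex_alg = (*)" "one complex_alg = 1"
  "zero complex_alg = 0" "add complex_alg = (+)" "smult complex_alg = (*)"
  by (simp_all add: complex_alg_def)

lemma cring_complex_alg: "cring complex_alg"
proof -
  have "\<exists>y. x + y = 0" for x :: complex
    by (rule exI[of _ "- x"]) simp
  then show ?thesis
    by (intro cringI) (auto intro!: abelian_groupI comm_monoidI simp: algebra_simps)
qed

text \<open>Additive inverses need no separate verification: from 0 x = 0 and distributivity over
  scalars, (-1) x is the negative of x.\<close>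

lemma complex_algebraI:
  fixes A (structure)
  assumes "\<And>x y. \<lbrakk>x \<in> carrier A; y \<in> carrier A\<rbrakk> \<Longrightarrow> x \<oplus> y \<in> carrier A"
    and "\<zero> \<in> carrier A"
    and "\<And>x y z. \<lbrakk>x \<in> carrier A; y \<in> carrier A; z \<in> carrier A\<rbrakk> \<Longrightarrow> (x \<oplus> y) \<oplus> z = x \<oplus> (y \<oplus> z)"
    and "\<And>x y. \<lbrakk>x \<in> carrier A; y \<in> carrier A\<rbrakk> \<Longrightarrow> x \<oplus> y = y \<oplus> x"
    and "\<And>x. x \<in> carrier A \<Longrightarrow> \<zero> \<oplus> x = x"
    and "\<And>x y. \<lbrakk>x \<in> carrier A; y \<in> carrier A\<rbrakk> \<Longrightarrow> x \<otimes> y \<in> carrier A"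
    and "\<one> \<in> carrier A"
    and "\<And>x y z. \<lbrakk>x \<in> carrier A; y \<in> carrier A; z \<in> carrier A\<rbrakk> \<Longrightarrow> (x \<otimes> y) \<otimes> z = x \<otimes> (y \<otimes> z)"
    and "\<And>x. x \<in> carrier A \<Longrightarrow> \<one> \<otimes> x = x"
    and "\<And>x. x \<in> carrier A \<Longrightarrow> x \<otimes> \<one> = x"
    and "\<And>x y z. \<lbrakk>x \<in> carrier A; y \<in> carrier A; z \<in> carrier A\<rbrakk> \<Longrightarrow> (x \<oplus> y) \<otimes> z = x \<otimes> z \<oplus> y \<otimes> z"
    and "\<And>x y z. \<lbrakk>x \<in> carrier A; y \<in> carrier A; z \<in> carrier A\<rbrakk> \<Longrightarrow> z \<otimes> (x \<oplus> y) = z \<otimes> x \<oplus> z \<otimes> y"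
    and smult: "\<And>s x. x \<in> carrier A \<Longrightarrow> s \<odot> x \<in> carrier A"
    and l: "\<And>s t x. x \<in> carrier A \<Longrightarrow> (s + t) \<odot> x = s \<odot> x \<oplus> t \<odot> x"
    and "\<And>s x y. \<lbrakk>x \<in> carrier A; y \<in> carrier A\<rbrakk> \<Longrightarrow> s \<odot> (x \<oplus> y) = s \<odot> x \<oplus> s \<odot> y"
    and "\<And>s t x. x \<in> carrier A \<Longrightarrow> (s * t) \<odot> x = s \<odot> (t \<odot> x)"
    and one: "\<And>x. x \<in> carrier A \<Longrightarrow> 1 \<odot> x = x"
    and zero: "\<And>x. x \<in> carrier A \<Longrightarrow> 0 \<odot> x = \<zero>"
    and "\<And>s x y. \<lbrakk>x \<in> carrier A; y \<in> carrier A\<rbrakk> \<Longrightarrow> (s \<odot> x) \<otimes> y = s \<odot> (x \<otimes> y)"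
    and "\<And>s x y. \<lbrakk>x \<in> carrier A; y \<in> carrier A\<rbrakk> \<Longrightarrow> x \<otimes> (s \<odot> y) = s \<odot> (x \<otimes> y)"
  shows "complex_algebra A"
proof -
  have inv: "\<exists>y\<in>carrier A. y \<oplus> x = \<zero>" if "x \<in> carrier A" for x
    using l[OF that, of "-1" 1] smult[OF that] one[OF that] zero[OF that]
    by (metis add.left_inverse)
  have ag: "abelian_group A"
    by (rule abelian_groupI) (use assms inv in auto)
  have "ring A"
    by (rule ringI[OF ag]) (use assms in \<open>auto intro: monoidI\<close>)
  moreover have "module complex_alg A"
    by (rule moduleI[OF cring_complex_alg ag]) (use assms in auto)
  ultimately show ?thesis
    by (intro complex_algebra.intro complex_algebra_axioms.intro) (use assms in auto)
qed

context complex_algebra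
begin

lemma smult_closed' [simp, intro]: "x \<in> carrier A \<Longrightarrow> s \<odot> x \<in> carrier A"
  by simp

lemma smult_add_left: "x \<in> carrier A \<Longrightarrow> (s + t) \<odot> x = s \<odot> x \<oplus> t \<odot> x"
  using smult_l_distr[of s t x] by simp

lemma smult_add_right: "\<lbrakk>x \<in> carrier A; y \<in> carrier A\<rbrakk> \<Longrightarrow> s \<odot> (x \<oplus> y) = s \<odot> x \<oplus> s \<odot> y"
  using smult_r_distr[of s x y] by simp

lemma smult_smult: "x \<in> carrier A \<Longrightarrow> s \<odot> (t \<odot> x) = (s * t) \<odot> x"
  using smult_assoc1[of s t x] by simp

lemma smult_1 [simp]: "x \<in> carrier A \<Longrightarrow> 1 \<odot> x = x"
  using smult_one[of x] by simp

lemma smult_0 [simp]: "x \<in> carrier A \<Longrightarrow> 0 \<odot> x = \<zero>"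
  using smult_l_null[of x] by simp

lemma smult_zero [simp]: "s \<odot> \<zero> = \<zero>"
  using smult_r_null[of s] by simp

lemma a_inv_eq_smult: "x \<in> carrier A \<Longrightarrow> \<ominus> x = (- 1) \<odot> x"
  using smult_add_left[of x "-1" 1] by (simp add: minus_equality)

end

lemma complex_algebra_complex_alg: "complex_algebra complex_alg"
  by (rule complex_algebraI) (auto simp: algebra_simps)

lemma complex_algebra_opposite:
  assumes "complex_algebra A"
  shows "complex_algebra (A\<lparr>mult := \<lambda>x y. y \<otimes>\<^bsub>A\<^esub> x\<rparr>)"
proof -
  interpret complex_algebra A by fact
  show ?thesis
    by (rule complex_algebraI)
      (simp_all add: a_ac m_assoc l_distr r_distr smult_add_left smult_add_right
        smult_smult smult_mult_left smult_mult_right)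
qed

lemma lin_homI:
  assumes "\<And>x. x \<in> carrier M \<Longrightarrow> f x \<in> carrier N"
    and "\<And>x y. \<lbrakk>x \<in> carrier M; y \<in> carrier M\<rbrakk> \<Longrightarrow> f (x \<oplus>\<^bsub>M\<^esub> y) = f x \<oplus>\<^bsub>N\<^esub> f y"
    and "\<And>s x. x \<in> carrier M \<Longrightarrow> f (s \<odot>\<^bsub>M\<^esub> x) = s \<odot>\<^bsub>N\<^esub> f x"
  shows "f \<in> lin_hom M N"
  using assms by (auto simp: lin_hom_def)

lemma lin_homD:
  assumes "f \<in> lin_hom M N"
  shows lin_hom_closed: "x \<in> carrier M \<Longrightarrow> f x \<in> carrier N"
    and lin_hom_add: "\<lbrakk>x \<in> carrier M; y \<in> carrier M\<rbrakk> \<Longrightarrow> f (x \<oplus>\<^bsub>M\<^esub> y) = f x \<oplus>\<^bsub>N\<^esub> f y"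
    and lin_hom_smult: "x \<in> carrier M \<Longrightarrow> f (s \<odot>\<^bsub>M\<^esub> x) = s \<odot>\<^bsub>N\<^esub> f x"
  using assms by (auto simp: lin_hom_def)

lemma lin_hom_zero:
  assumes "complex_algebra M" "complex_algebra N" "f \<in> lin_hom M N"
  shows "f \<zero>\<^bsub>M\<^esub> = \<zero>\<^bsub>N\<^esub>"
proof -
  interpret M: complex_algebra M by fact
  interpret N: complex_algebra N by fact
  show ?thesis
    using lin_hom_smult[OF assms(3), of "\<zero>\<^bsub>M\<^esub>" 0] lin_hom_closed[OF assms(3), of "\<zero>\<^bsub>M\<^esub>"] by simp
qed

lemma alg_homI:
  assumes "f \<in> lin_hom A B"
    and "\<And>x y. \<lbrakk>x \<in> carrier A; y \<in> carrier A\<rbrakk> \<Longrightarrow> f (x \<otimes>\<^bsub>A\<^esub> y) = f x \<otimes>\<^bsub>B\<^esub> f y"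
    and "f \<one>\<^bsub>A\<^esub> = \<one>\<^bsub>B\<^esub>"
  shows "f \<in> alg_hom A B"
  using assms by (auto simp: alg_hom_def lin_hom_def intro: ring_hom_memI)

lemma alg_homD:
  assumes "f \<in> alg_hom A B"
  shows alg_hom_lin: "f \<in> lin_hom A B"
    and alg_hom_closed: "x \<in> carrier A \<Longrightarrow> f x \<in> carrier B"
    and alg_hom_add: "\<lbrakk>x \<in> carrier A; y \<in> carrier A\<rbrakk> \<Longrightarrow> f (x \<oplus>\<^bsub>A\<^esub> y) = f x \<oplus>\<^bsub>B\<^esub> f y"
    and alg_hom_mult: "\<lbrakk>x \<in> carrier A; y \<in> carrier A\<rbrakk> \<Longrightarrow> f (x \<otimes>\<^bsub>A\<^esub> y) = f x \<otimes>\<^bsub>B\<^esub> f y"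
    and alg_hom_one: "f \<one>\<^bsub>A\<^esub> = \<one>\<^bsub>B\<^esub>"
    and alg_hom_smult: "x \<in> carrier A \<Longrightarrow> f (s \<odot>\<^bsub>A\<^esub> x) = s \<odot>\<^bsub>B\<^esub> f x"
  using assms by (auto simp: alg_hom_def lin_hom_def ring_hom_def)

lemma alg_hom_id: "(\<lambda>x. x) \<in> alg_hom A A"
  by (auto simp: alg_hom_def lin_hom_def ring_hom_def)

lemma alg_hom_comp:
  assumes "f \<in> alg_hom A B" "g \<in> alg_hom B C"
  shows "(\<lambda>x. g (f x)) \<in> alg_hom A C"
  using assms by (auto simp: alg_hom_def lin_hom_def ring_hom_def Pi_iff)

text \<open>A submodule maximal among those avoiding \<open>x\<close> is a hyperplane complementary to the line
  through \<open>x\<close>, so the coordinate along \<open>x\<close> is a functional.\<close>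

lemma (in complex_algebra) ex_functional:
  assumes x: "x \<in> carrier A" "x \<noteq> \<zero>"
  shows "\<exists>\<phi>\<in>lin_hom A complex_alg. \<phi> x = 1"
proof -
  define sub where "sub N \<longleftrightarrow> N \<subseteq> carrier A \<and> \<zero> \<in> N \<and> (\<forall>u\<in>N. \<forall>v\<in>N. u \<oplus> v \<in> N) \<and>
    (\<forall>s. \<forall>u\<in>N. s \<odot> u \<in> N)" for N
  define \<N> where "\<N> = {N. sub N \<and> x \<notin> N}"
  have "{\<zero>} \<in> \<N>"
    using x by (auto simp: \<N>_def sub_def)
  then have "\<N> \<noteq> {}" by blast
  moreover have "\<Union>\<C> \<in> \<N>" if "\<C> \<noteq> {}" "subset.chain \<N> \<C>" for \<C>
  proof -
    have *: "\<And>N. N \<in> \<C> \<Longrightarrow> sub N \<and> x \<notin> N" and ch: "\<And>M N. M \<in> \<C> \<Longrightarrow> N \<in> \<C> \<Longrightarrow> M \<subseteq> N \<or> N \<subseteq> M"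
      using that by (auto simp: subset_chain_def \<N>_def)
    have "u \<oplus> v \<in> \<Union>\<C>" if "u \<in> \<Union>\<C>" "v \<in> \<Union>\<C>" for u v
    proof -
      from that obtain M N where "M \<in> \<C>" "u \<in> M" "N \<in> \<C>" "v \<in> N" by blast
      with ch[of M N] * show ?thesis unfolding sub_def by blast
    qed
    then have "sub (\<Union>\<C>)"
      using * \<open>\<C> \<noteq> {}\<close> unfolding sub_def by blast
    with * show ?thesis unfolding \<N>_def by blast
  qed
  ultimately obtain N where N: "N \<in> \<N>" and max: "\<And>M. M \<in> \<N> \<Longrightarrow> N \<subseteq> M \<Longrightarrow> M = N"
    using subset_Zorn_nonempty[of \<N>] by metis
  have subN: "N \<subseteq> carrier A" "\<zero> \<in> N" "x \<notin> N"
    and add: "\<And>u v. u \<in> N \<Longrightarrow> v \<in> N \<Longrightarrow> u \<oplus> v \<in> N" and sm: "\<And>s u. u \<in> N \<Longrightarrow> s \<odot> u \<in> N"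
    using N by (auto simp: \<N>_def sub_def)
  have ex: "\<exists>s n. n \<in> N \<and> y = s \<odot> x \<oplus> n" if y: "y \<in> carrier A" for y
  proof (cases "y \<in> N")
    case True
    then show ?thesis using x y by (intro exI[of _ 0] exI[of _ y]) simp
  next
    case False
    \<comment> \<open>M is N plus the line through y. It is strictly larger than N, so by maximality
      it contains x. The coefficient of y in x is nonzero because x is not in N, and the equation
      can be solved for y.\<close>
    define M where "M = {s \<odot> y \<oplus> n | s n. n \<in> N}"
    have "sub M"
      unfolding sub_def
    proof (intro conjI ballI allI)
      show "M \<subseteq> carrier A" using y subN by (auto simp: M_def)
      show "\<zero> \<in> M" using y subN unfolding M_def
        by (auto intro!: exI[of _ 0] exI[of _ "\<zero>"])
      fix u v assume "u \<in> M" "v \<in> M"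
      then obtain s n t m where "u = s \<odot> y \<oplus> n" "v = t \<odot> y \<oplus> m" "n \<in> N" "m \<in> N"
        by (auto simp: M_def)
      moreover from this have "u \<oplus> v = (s + t) \<odot> y \<oplus> (n \<oplus> m)"
        using y subN by (auto simp: smult_add_left add.m_ac subset_iff)
      ultimately show "u \<oplus> v \<in> M"
        using add unfolding M_def by blast
    next
      fix s u assume "u \<in> M"
      then obtain t n where "u = t \<odot> y \<oplus> n" "n \<in> N" by (auto simp: M_def)
      moreover from this have "s \<odot> u = (s * t) \<odot> y \<oplus> s \<odot> n"
        using y subN by (auto simp: smult_add_right smult_smult subset_iff)
      ultimately show "s \<odot> u \<in> M" using sm unfolding M_def by blast
    qed
    moreover have "N \<subseteq> M"
    proof
      fix n assume "n \<in> N"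
      then show "n \<in> M" using y subN unfolding M_def
        by (auto intro!: exI[of _ 0] exI[of _ n])
    qed
    moreover have "y \<in> M" using y subN unfolding M_def
      by (auto intro!: exI[of _ 1] exI[of _ \<zero>])
    ultimately have "x \<in> M"
      using max[of M] False unfolding \<N>_def by blast
    then obtain s n where sn: "x = s \<odot> y \<oplus> n" "n \<in> N" by (auto simp: M_def)
    then have "s \<noteq> 0" using subN y by (auto simp: subset_iff)
    have nc: "n \<in> carrier A" using sn subN by blast
    have "y = inverse s \<odot> (s \<odot> y)" using \<open>s \<noteq> 0\<close> y by (simp add: smult_smult)
    also have "s \<odot> y = x \<oplus> (- 1) \<odot> n"
      using sn y nc by (simp add: a_inv_eq_smult[symmetric] add.m_assoc r_neg)
    finally have "y = inverse s \<odot> x \<oplus> (inverse s * (- 1)) \<odot> n"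
      using nc x by (simp add: smult_add_right smult_smult)
    then show ?thesis using sm sn by blast
  qed
  \<comment> \<open>Otherwise a nonzero multiple of x lies in N, and dividing by the scalar puts x
    itself in N. This makes the coordinate chosen by \<open>THE\<close> well defined.\<close>
  have uniq: "s = t" if "s \<odot> x \<oplus> n = t \<odot> x \<oplus> m" "n \<in> N" "m \<in> N" for s t n m
  proof (rule ccontr)
    assume "s \<noteq> t"
    have nm: "n \<in> carrier A" "m \<in> carrier A" using that subN by auto
    have "(s - t) \<odot> x = s \<odot> x \<oplus> (- t) \<odot> x"
      using smult_add_left[OF x(1), of s "- t"] by simp
    also have "s \<odot> x = t \<odot> x \<oplus> m \<oplus> (- 1) \<odot> n"
      using that(1)[symmetric] nm x by (simp add: a_inv_eq_smult[symmetric] add.m_assoc r_neg)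
    also have "\<dots> \<oplus> (- t) \<odot> x = m \<oplus> (- 1) \<odot> n \<oplus> (t + - t) \<odot> x"
      using nm x unfolding smult_add_left[OF x(1)] by (simp add: add.m_ac)
    finally have "(s - t) \<odot> x \<in> N"
      using nm x that add sm by simp
    then have "inverse (s - t) \<odot> ((s - t) \<odot> x) \<in> N" by (rule sm)
    then show False using \<open>s \<noteq> t\<close> x subN by (simp add: smult_smult)
  qed
  define \<phi> where "\<phi> y = (THE s. \<exists>n\<in>N. y = s \<odot> x \<oplus> n)" for y
  have \<phi>: "\<phi> (s \<odot> x \<oplus> n) = s" if "n \<in> N" for s n
    unfolding \<phi>_def using that uniq by blast
  have "\<phi> \<in> lin_hom A complex_alg"
  proof (rule lin_homI)
    fix y z assume "y \<in> carrier A" "z \<in> carrier A"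
    then obtain s n t m where *: "y = s \<odot> x \<oplus> n" "z = t \<odot> x \<oplus> m" "n \<in> N" "m \<in> N"
      using ex by metis
    then have "y \<oplus> z = (s + t) \<odot> x \<oplus> (n \<oplus> m)"
      using x subN by (auto simp: smult_add_left add.m_ac subset_iff)
    then show "\<phi> (y \<oplus> z) = \<phi> y \<oplus>\<^bsub>complex_alg\<^esub> \<phi> z"
      using * \<phi> add by simp
  next
    fix s y assume "y \<in> carrier A"
    then obtain t n where *: "y = t \<odot> x \<oplus> n" "n \<in> N" using ex by metis
    then have "s \<odot> y = (s * t) \<odot> x \<oplus> s \<odot> n"
      using x subN by (auto simp: smult_add_right smult_smult subset_iff)
    then show "\<phi> (s \<odot> y) = s \<odot>\<^bsub>complex_alg\<^esub> \<phi> y"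
      using * \<phi> sm by simp
  qed simp
  moreover have "\<phi> x = 1"
    using \<phi>[of \<zero> 1] subN x by simp
  ultimately show ?thesis by blast
qed

text \<open>The exit from noncommutative algebra into complex arithmetic. It also works on
  hypotheses: a relation known in the algebra becomes, for each functional, a linear equation that
  can be solved for one of its terms.\<close>

lemma (in complex_algebra) eq_functionalI:
  assumes x: "x \<in> carrier A" and y: "y \<in> carrier A"
    and eq: "\<And>\<phi>. \<phi> \<in> lin_hom A complex_alg \<Longrightarrow> \<phi> x = \<phi> y"
  shows "x = y"
proof (rule ccontr)
  assume "x \<noteq> y"
  define z where "z = x \<oplus> (- 1) \<odot> y"
  have z: "z \<in> carrier A" using x y by (simp add: z_def)
  have "z \<noteq> \<zero>"
    using x y \<open>x \<noteq> y\<close> by (metis z_def a_inv_eq_smult a_inv_closed minus_equality minus_minus)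
  with ex_functional z obtain \<phi> where \<phi>: "\<phi> \<in> lin_hom A complex_alg" "\<phi> z = 1" by blast
  then have "\<phi> z = \<phi> x - \<phi> y"
    using x y by (simp add: z_def lin_hom_add lin_hom_smult)
  with \<phi>(2) eq[OF \<phi>(1)] show False by simp
qed

section \<open>Monoid algebras and quotients\<close>

lemma lookup_map_mult [simp]:
  "Poly_Mapping.lookup (Poly_Mapping.map ((*) s) f) k = s * Poly_Mapping.lookup f k"
  for s :: complex
  by (simp add: Poly_Mapping.map.rep_eq when_def)

lemma map_mult_single [simp]:
  "Poly_Mapping.map ((*) s) (Poly_Mapping.single k c) = Poly_Mapping.single k (s * c)"
  for s :: complex
  by (rule poly_mapping_eqI) (simp add: lookup_single when_def)

lemma map_mult_add:
  "Poly_Mapping.map ((*) s) (f + g) = Poly_Mapping.map ((*) s) f + Poly_Mapping.map ((*) s) g"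
  for s :: complex
  by (rule poly_mapping_eqI) (simp add: lookup_add algebra_simps)

lemma map_mult_simps:
  "Poly_Mapping.map ((*) (s + t)) f = Poly_Mapping.map ((*) s) f + Poly_Mapping.map ((*) t) f"
  "Poly_Mapping.map ((*) (s * t)) f = Poly_Mapping.map ((*) s) (Poly_Mapping.map ((*) t) f)"
  "Poly_Mapping.map ((*) 1) f = f" "Poly_Mapping.map ((*) 0) f = 0"
  for s :: complex
  by (auto intro!: poly_mapping_eqI simp: lookup_add algebra_simps)

lemma map_mult_uminus: "Poly_Mapping.map ((*) (- 1)) f = - f" for f :: "'k \<Rightarrow>\<^sub>0 complex"
  by (rule poly_mapping_eqI) simp

lemma keys_map_mult: "Poly_Mapping.keys (Poly_Mapping.map ((*) s) f) \<subseteq> Poly_Mapping.keys f"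
  for s :: complex
  by (auto simp: in_keys_iff)

lemma keys_diff_subset: "Poly_Mapping.keys (f - g) \<subseteq> Poly_Mapping.keys f \<union> Poly_Mapping.keys g"
  for f :: "'k \<Rightarrow>\<^sub>0 complex"
  by (auto simp: in_keys_iff lookup_minus)

lemma keys_add_subsetI:
  "\<lbrakk>Poly_Mapping.keys f \<subseteq> C; Poly_Mapping.keys g \<subseteq> C\<rbrakk> \<Longrightarrow> Poly_Mapping.keys (f + g) \<subseteq> C"
  using Poly_Mapping.keys_add[of f g] by blast

text \<open>The step asks neither for a fresh key nor for a nonzero coefficient, so a property
  passes it as soon as it holds for single terms and is preserved by addition. Multilinear
  identities are reduced to basis elements this way, one argument at a time.\<close>

lemma keys_subset_induct [consumes 1, case_names zero single_add]:
  fixes f :: "'k \<Rightarrow>\<^sub>0 'c::comm_monoid_add"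
  assumes "Poly_Mapping.keys f \<subseteq> C"
    and zero: "P 0"
    and step: "\<And>k c g. \<lbrakk>k \<in> C; Poly_Mapping.keys g \<subseteq> C; P g\<rbrakk> \<Longrightarrow> P (Poly_Mapping.single k c + g)"
  shows "P f"
proof -
  have "P (\<Sum>k\<in>K. Poly_Mapping.single k (Poly_Mapping.lookup f k)) \<and>
      Poly_Mapping.keys (\<Sum>k\<in>K. Poly_Mapping.single k (Poly_Mapping.lookup f k)) \<subseteq> C"
    if "finite K" "K \<subseteq> C" for K
    using that
  proof (induction K)
    case (insert x F)
    then show ?case
      by (simp add: step keys_add_subsetI)
  qed (simp add: zero)
  moreover have "(\<Sum>k\<in>Poly_Mapping.keys f. Poly_Mapping.single k (Poly_Mapping.lookup f k)) = f"
    by (rule poly_mapping_eqI) (simp add: lookup_sum lookup_single when_def in_keys_iff)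
  ultimately show ?thesis
    using assms(1) by (metis finite_keys)
qed

lemma monoid_alg_simps:
  "carrier (monoid_alg G) = {f. Poly_Mapping.keys f \<subseteq> carrier G}"
  "one (monoid_alg G) = Poly_Mapping.single \<one>\<^bsub>G\<^esub> 1"
  "zero (monoid_alg G) = 0" "add (monoid_alg G) = (+)"
  "smult (monoid_alg G) = (\<lambda>s. Poly_Mapping.map ((*) s))"
  by (simp_all add: monoid_alg_def)

text \<open>The defining sum runs over the supports, and the support of a sum can shrink by
  cancellation. Over a common finite superset, additivity of the product is mere distributivity of
  finite sums.\<close>

lemma monoid_alg_mult_superset:
  assumes "finite X" "Poly_Mapping.keys f \<subseteq> X" "finite Y" "Poly_Mapping.keys g \<subseteq> Y"
  shows "f \<otimes>\<^bsub>monoid_alg G\<^esub> g = (\<Sum>x\<in>X. \<Sum>y\<in>Y. Poly_Mapping.single (x \<otimes>\<^bsub>G\<^esub> y)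
    (Poly_Mapping.lookup f x * Poly_Mapping.lookup g y))"
proof -
  have "f \<otimes>\<^bsub>monoid_alg G\<^esub> g = (\<Sum>x\<in>Poly_Mapping.keys f. \<Sum>y\<in>Poly_Mapping.keys g.
      Poly_Mapping.single (x \<otimes>\<^bsub>G\<^esub> y) (Poly_Mapping.lookup f x * Poly_Mapping.lookup g y))"
    by (simp add: monoid_alg_def)
  also have "\<dots> = (\<Sum>x\<in>Poly_Mapping.keys f. \<Sum>y\<in>Y.
      Poly_Mapping.single (x \<otimes>\<^bsub>G\<^esub> y) (Poly_Mapping.lookup f x * Poly_Mapping.lookup g y))"
    by (intro sum.cong refl sum.mono_neutral_left) (use assms in \<open>auto simp: in_keys_iff\<close>)
  also have "\<dots> = (\<Sum>x\<in>X. \<Sum>y\<in>Y.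
      Poly_Mapping.single (x \<otimes>\<^bsub>G\<^esub> y) (Poly_Mapping.lookup f x * Poly_Mapping.lookup g y))"
    by (intro sum.mono_neutral_left) (use assms in \<open>auto simp: in_keys_iff\<close>)
  finally show ?thesis .
qed

lemma monoid_alg_mult_single:
  "Poly_Mapping.single x s \<otimes>\<^bsub>monoid_alg G\<^esub> Poly_Mapping.single y t
    = Poly_Mapping.single (x \<otimes>\<^bsub>G\<^esub> y) (s * t)"
  by (subst monoid_alg_mult_superset[of "{x}" _ "{y}"]) auto

lemma monoid_alg_mult_add_left:
  "(f + f') \<otimes>\<^bsub>monoid_alg G\<^esub> g = f \<otimes>\<^bsub>monoid_alg G\<^esub> g + f' \<otimes>\<^bsub>monoid_alg G\<^esub> g"
  (is "?m (f + f') g = _")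
proof -
  let ?X = "Poly_Mapping.keys f \<union> Poly_Mapping.keys f'" and ?Y = "Poly_Mapping.keys g"
  have *: "?m h g = (\<Sum>x\<in>?X. \<Sum>y\<in>?Y. Poly_Mapping.single (x \<otimes>\<^bsub>G\<^esub> y)
      (Poly_Mapping.lookup h x * Poly_Mapping.lookup g y))" if "Poly_Mapping.keys h \<subseteq> ?X" for h
    by (rule monoid_alg_mult_superset) (use that in auto)
  show ?thesis
    by (subst (1 2 3) *)
      (auto simp: Poly_Mapping.keys_add lookup_add algebra_simps single_add sum.distrib)
qed

lemma monoid_alg_mult_add_right:
  "g \<otimes>\<^bsub>monoid_alg G\<^esub> (f + f') = g \<otimes>\<^bsub>monoid_alg G\<^esub> f + g \<otimes>\<^bsub>monoid_alg G\<^esub> f'"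
  (is "?m g (f + f') = _")
proof -
  let ?X = "Poly_Mapping.keys f \<union> Poly_Mapping.keys f'" and ?Y = "Poly_Mapping.keys g"
  have *: "?m g h = (\<Sum>x\<in>?Y. \<Sum>y\<in>?X. Poly_Mapping.single (x \<otimes>\<^bsub>G\<^esub> y)
      (Poly_Mapping.lookup g x * Poly_Mapping.lookup h y))" if "Poly_Mapping.keys h \<subseteq> ?X" for h
    by (rule monoid_alg_mult_superset) (use that in auto)
  show ?thesis
    by (subst (1 2 3) *)
      (auto simp: Poly_Mapping.keys_add lookup_add algebra_simps single_add sum.distrib)
qed

lemma monoid_alg_mult_zero [simp]:
  "0 \<otimes>\<^bsub>monoid_alg G\<^esub> f = 0" "f \<otimes>\<^bsub>monoid_alg G\<^esub> 0 = 0"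
  by (simp_all add: monoid_alg_def)

lemma monoid_alg_mult_uminus:
  "(- f) \<otimes>\<^bsub>monoid_alg G\<^esub> g = - (f \<otimes>\<^bsub>monoid_alg G\<^esub> g)"
  "g \<otimes>\<^bsub>monoid_alg G\<^esub> (- f) = - (g \<otimes>\<^bsub>monoid_alg G\<^esub> f)"
  using monoid_alg_mult_add_left[where f = "- f" and f' = f and g = g and G = G]
    monoid_alg_mult_add_right[where f = "- f" and f' = f and g = g and G = G]
  by (simp_all add: eq_neg_iff_add_eq_0)

lemma monoid_alg_mult_diff:
  "(f - f') \<otimes>\<^bsub>monoid_alg G\<^esub> g = f \<otimes>\<^bsub>monoid_alg G\<^esub> g - f' \<otimes>\<^bsub>monoid_alg G\<^esub> g"
  "g \<otimes>\<^bsub>monoid_alg G\<^esub> (f - f') = g \<otimes>\<^bsub>monoid_alg G\<^esub> f - g \<otimes>\<^bsub>monoid_alg G\<^esub> f'"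
  using monoid_alg_mult_add_left[where f = f and f' = "- f'" and g = g and G = G]
    monoid_alg_mult_add_right[where f = f and f' = "- f'" and g = g and G = G]
  by (simp_all add: monoid_alg_mult_uminus)

lemma monoid_alg_mult_smult:
  "Poly_Mapping.map ((*) s) f \<otimes>\<^bsub>monoid_alg G\<^esub> g = Poly_Mapping.map ((*) s) (f \<otimes>\<^bsub>monoid_alg G\<^esub> g)"
  "f \<otimes>\<^bsub>monoid_alg G\<^esub> Poly_Mapping.map ((*) s) g = Poly_Mapping.map ((*) s) (f \<otimes>\<^bsub>monoid_alg G\<^esub> g)"
proof -
  have 1: "Poly_Mapping.map ((*) s) 0 = (0 :: 'a \<Rightarrow>\<^sub>0 complex)"
    by (rule poly_mapping_eqI) simp
  have f: "Poly_Mapping.keys f \<subseteq> UNIV" and g: "Poly_Mapping.keys g \<subseteq> UNIV" by auto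
  have 2: "Poly_Mapping.map ((*) s) (Poly_Mapping.single k c) \<otimes>\<^bsub>monoid_alg G\<^esub> g
      = Poly_Mapping.map ((*) s) (Poly_Mapping.single k c \<otimes>\<^bsub>monoid_alg G\<^esub> g)"
    "Poly_Mapping.single k c \<otimes>\<^bsub>monoid_alg G\<^esub> Poly_Mapping.map ((*) s) g
      = Poly_Mapping.map ((*) s) (Poly_Mapping.single k c \<otimes>\<^bsub>monoid_alg G\<^esub> g)" for k c
    using g
    by (induction g rule: keys_subset_induct)
      (auto simp: 1 map_mult_add monoid_alg_mult_add_left monoid_alg_mult_add_right
        monoid_alg_mult_single algebra_simps)
  show "Poly_Mapping.map ((*) s) f \<otimes>\<^bsub>monoid_alg G\<^esub> g = Poly_Mapping.map ((*) s) (f \<otimes>\<^bsub>monoid_alg G\<^esub> g)"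
    using f by (induction f rule: keys_subset_induct)
      (use 2 in \<open>auto simp: 1 map_mult_add monoid_alg_mult_add_left simp del: map_mult_single\<close>)
  show "f \<otimes>\<^bsub>monoid_alg G\<^esub> Poly_Mapping.map ((*) s) g = Poly_Mapping.map ((*) s) (f \<otimes>\<^bsub>monoid_alg G\<^esub> g)"
    using f by (induction f rule: keys_subset_induct)
      (use 2 in \<open>auto simp: 1 map_mult_add monoid_alg_mult_add_left simp del: map_mult_single\<close>)
qed

lemma monoid_alg_mult_closed:
  assumes "monoid G" "f \<in> carrier (monoid_alg G)" "g \<in> carrier (monoid_alg G)"
  shows "f \<otimes>\<^bsub>monoid_alg G\<^esub> g \<in> carrier (monoid_alg G)"
proof -
  interpret monoid G by fact
  have g: "Poly_Mapping.keys g \<subseteq> carrier G" using assms by (simp add: monoid_alg_simps)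
  have f: "Poly_Mapping.keys f \<subseteq> carrier G" using assms by (simp add: monoid_alg_simps)
  have 1: "Poly_Mapping.keys (Poly_Mapping.single k c \<otimes>\<^bsub>monoid_alg G\<^esub> g) \<subseteq> carrier G"
    if "k \<in> carrier G" for k c
    using g by (induction g rule: keys_subset_induct)
      (use that in \<open>simp_all add: monoid_alg_mult_add_right monoid_alg_mult_single
        keys_add_subsetI\<close>)
  have "Poly_Mapping.keys (f \<otimes>\<^bsub>monoid_alg G\<^esub> g) \<subseteq> carrier G"
    using f by (induction f rule: keys_subset_induct)
      (use 1 in \<open>simp_all add: monoid_alg_mult_add_left keys_add_subsetI\<close>)
  then show ?thesis by (simp add: monoid_alg_simps)
qed

lemma monoid_alg_mult_assoc:
  assumes "monoid G" "f \<in> carrier (monoid_alg G)" "g \<in> carrier (monoid_alg G)"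
    "h \<in> carrier (monoid_alg G)"
  shows "(f \<otimes>\<^bsub>monoid_alg G\<^esub> g) \<otimes>\<^bsub>monoid_alg G\<^esub> h = f \<otimes>\<^bsub>monoid_alg G\<^esub> (g \<otimes>\<^bsub>monoid_alg G\<^esub> h)"
    (is "?m (?m f g) h = _")
proof -
  interpret monoid G by fact
  have fgh: "Poly_Mapping.keys f \<subseteq> carrier G" "Poly_Mapping.keys g \<subseteq> carrier G"
    "Poly_Mapping.keys h \<subseteq> carrier G" using assms by (auto simp: monoid_alg_simps)
  let ?s = Poly_Mapping.single
  have 1: "?m (?m (?s j b) (?s k c)) h = ?m (?s j b) (?m (?s k c) h)"
    if "j \<in> carrier G" "k \<in> carrier G" for j k b c
    using fgh(3) by (induction h rule: keys_subset_induct)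
      (use that in \<open>auto simp: monoid_alg_mult_add_right monoid_alg_mult_single m_assoc algebra_simps\<close>)
  have 2: "?m (?m (?s j b) g) h = ?m (?s j b) (?m g h)" if "j \<in> carrier G" for j b
    using fgh(2) by (induction g rule: keys_subset_induct)
      (use that 1 in \<open>auto simp: monoid_alg_mult_add_right monoid_alg_mult_add_left\<close>)
  show ?thesis
    using fgh(1) by (induction f rule: keys_subset_induct)
      (use 2 in \<open>auto simp: monoid_alg_mult_add_left\<close>)
qed

lemma monoid_alg_mult_one:
  assumes "monoid G" "f \<in> carrier (monoid_alg G)"
  shows "\<one>\<^bsub>monoid_alg G\<^esub> \<otimes>\<^bsub>monoid_alg G\<^esub> f = f" "f \<otimes>\<^bsub>monoid_alg G\<^esub> \<one>\<^bsub>monoid_alg G\<^esub> = f"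
proof -
  interpret monoid G by fact
  have f: "Poly_Mapping.keys f \<subseteq> carrier G" using assms by (simp add: monoid_alg_simps)
  show "\<one>\<^bsub>monoid_alg G\<^esub> \<otimes>\<^bsub>monoid_alg G\<^esub> f = f" "f \<otimes>\<^bsub>monoid_alg G\<^esub> \<one>\<^bsub>monoid_alg G\<^esub> = f"
    using f by (induction f rule: keys_subset_induct)
      (auto simp: monoid_alg_simps monoid_alg_mult_add_left monoid_alg_mult_add_right
        monoid_alg_mult_single)
qed

lemma complex_algebra_monoid_alg:
  assumes "monoid G"
  shows "complex_algebra (monoid_alg G)"
proof (rule complex_algebraI)
  show "x \<oplus>\<^bsub>monoid_alg G\<^esub> y \<in> carrier (monoid_alg G)"
    if "x \<in> carrier (monoid_alg G)" "y \<in> carrier (monoid_alg G)" for x y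
    using that by (simp add: monoid_alg_simps keys_add_subsetI)
  show "s \<odot>\<^bsub>monoid_alg G\<^esub> x \<in> carrier (monoid_alg G)" if "x \<in> carrier (monoid_alg G)" for x s
    using that keys_map_mult[of s x] by (auto simp: monoid_alg_simps)
  show "\<one>\<^bsub>monoid_alg G\<^esub> \<in> carrier (monoid_alg G)"
    using monoid.one_closed[OF assms] by (simp add: monoid_alg_simps)
qed (simp_all only: assms monoid_alg_mult_closed monoid_alg_mult_assoc monoid_alg_mult_one,
    simp_all add: monoid_alg_simps monoid_alg_mult_add_left monoid_alg_mult_add_right
      monoid_alg_mult_smult add_ac map_mult_add map_mult_simps)

section \<open>Linear extension of functions on a basis\<close>

context complex_algebra
begin

text \<open>As for the product, a common finite index set lets the values at two combinations and at
  their sum be compared term by term.\<close>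

lemma lin_ext_superset:
  assumes "finite K" "Poly_Mapping.keys f \<subseteq> K" "\<And>k. k \<in> K \<Longrightarrow> \<phi> k \<in> carrier A"
  shows "lin_ext A \<phi> f = (\<Oplus>k\<in>K. Poly_Mapping.lookup f k \<odot> \<phi> k)"
  unfolding lin_ext_def
  by (rule add.finprod_mono_neutral_cong_left) (use assms in \<open>auto simp: in_keys_iff\<close>)

lemma lin_ext_lin_hom:
  assumes \<phi>: "\<And>k. k \<in> carrier G \<Longrightarrow> \<phi> k \<in> carrier A"
  shows "lin_ext A \<phi> \<in> lin_hom (monoid_alg G) A"
proof (rule lin_homI)
  fix f g assume fg: "f \<in> carrier (monoid_alg G)" "g \<in> carrier (monoid_alg G)"
  let ?K = "Poly_Mapping.keys f \<union> Poly_Mapping.keys g"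
  have K: "\<phi> k \<in> carrier A" if "k \<in> ?K" for k
    using that fg \<phi> by (auto simp: monoid_alg_simps)
  have *: "lin_ext A \<phi> h = (\<Oplus>k\<in>?K. Poly_Mapping.lookup h k \<odot> \<phi> k)" if "Poly_Mapping.keys h \<subseteq> ?K" for h
    by (rule lin_ext_superset) (use that K in auto)
  have "lin_ext A \<phi> (f + g) = (\<Oplus>k\<in>?K. Poly_Mapping.lookup f k \<odot> \<phi> k \<oplus> Poly_Mapping.lookup g k \<odot> \<phi> k)"
    using K unfolding *[OF Poly_Mapping.keys_add] by (intro finsum_cong') (auto simp: lookup_add smult_add_left)
  also have "\<dots> = lin_ext A \<phi> f \<oplus> lin_ext A \<phi> g"
    using K by (subst (1 2) *) (auto intro!: finsum_addf)
  finally show "lin_ext A \<phi> (f \<oplus>\<^bsub>monoid_alg G\<^esub> g) = lin_ext A \<phi> f \<oplus> lin_ext A \<phi> g"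
    by (simp add: monoid_alg_simps)
next
  fix s f assume f: "f \<in> carrier (monoid_alg G)"
  have K: "\<phi> k \<in> carrier A" if "k \<in> Poly_Mapping.keys f" for k
    using that f \<phi> by (auto simp: monoid_alg_simps)
  show "lin_ext A \<phi> f \<in> carrier A"
    unfolding lin_ext_def using K by (intro finsum_closed) auto
  have "lin_ext A \<phi> (Poly_Mapping.map ((*) s) f)
      = (\<Oplus>k\<in>Poly_Mapping.keys f. (s * Poly_Mapping.lookup f k) \<odot> \<phi> k)"
    by (subst lin_ext_superset[of "Poly_Mapping.keys f"]) (use K in \<open>simp_all add: keys_map_mult\<close>)
  also have "\<dots> = (\<Oplus>k\<in>Poly_Mapping.keys f. s \<odot> (Poly_Mapping.lookup f k \<odot> \<phi> k))"
    using K by (intro finsum_cong') (auto simp: smult_smult)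
  also have "\<dots> = s \<odot> lin_ext A \<phi> f"
    unfolding lin_ext_def using K by (intro finsum_smult_ldistr[symmetric]) auto
  finally show "lin_ext A \<phi> (s \<odot>\<^bsub>monoid_alg G\<^esub> f) = s \<odot> lin_ext A \<phi> f"
    by (simp add: monoid_alg_simps)
qed

lemma lin_ext_single [simp]: "\<phi> k \<in> carrier A \<Longrightarrow> lin_ext A \<phi> (Poly_Mapping.single k c) = c \<odot> \<phi> k"
  by (subst lin_ext_superset[of "{k}"]) auto

lemma lin_ext_zero [simp]: "lin_ext A \<phi> 0 = \<zero>"
  by (simp add: lin_ext_def)

lemma lin_ext_alg_hom:
  assumes "monoid G" and \<phi>: "\<And>k. k \<in> carrier G \<Longrightarrow> \<phi> k \<in> carrier A"
    and mult: "\<And>k l. \<lbrakk>k \<in> carrier G; l \<in> carrier G\<rbrakk> \<Longrightarrow> \<phi> (k \<otimes>\<^bsub>G\<^esub> l) = \<phi> k \<otimes> \<phi> l"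
    and one: "\<phi> \<one>\<^bsub>G\<^esub> = \<one>"
  shows "lin_ext A \<phi> \<in> alg_hom (monoid_alg G) A"
proof -
  interpret G: monoid G by fact
  interpret MG: complex_algebra "monoid_alg G" by (rule complex_algebra_monoid_alg) fact
  have lin: "lin_ext A \<phi> \<in> lin_hom (monoid_alg G) A" by (rule lin_ext_lin_hom) fact
  have s: "Poly_Mapping.single k c \<in> carrier (monoid_alg G)" if "k \<in> carrier G" for k c
    using that by (simp add: monoid_alg_simps)
  note add = lin_hom_add[OF lin, unfolded monoid_alg_simps(4)]
  note c = lin_hom_closed[OF lin] MG.add.m_closed[unfolded monoid_alg_simps(4)]
  show ?thesis
  proof (rule alg_homI[OF lin])
    show "lin_ext A \<phi> \<one>\<^bsub>monoid_alg G\<^esub> = \<one>"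
      using \<phi> one by (simp add: monoid_alg_simps)
    fix f g assume f: "f \<in> carrier (monoid_alg G)" and g: "g \<in> carrier (monoid_alg G)"
    have 1: "lin_ext A \<phi> (Poly_Mapping.single k b \<otimes>\<^bsub>monoid_alg G\<^esub> g)
        = lin_ext A \<phi> (Poly_Mapping.single k b) \<otimes> lin_ext A \<phi> g" if k: "k \<in> carrier G" for k b
      using g unfolding monoid_alg_simps(1) mem_Collect_eq
    proof (induction g rule: keys_subset_induct)
      case zero
      then show ?case using k \<phi> by simp
    next
      case (single_add l d g)
      then have "g \<in> carrier (monoid_alg G)" by (simp add: monoid_alg_simps)
      with single_add k \<phi> mult show ?case
        by (simp add: monoid_alg_mult_add_right add s c r_distr)
         (simp add: monoid_alg_mult_single smult_mult_left smult_mult_right smult_smult mult.commute s c)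
    qed
    show "lin_ext A \<phi> (f \<otimes>\<^bsub>monoid_alg G\<^esub> g) = lin_ext A \<phi> f \<otimes> lin_ext A \<phi> g"
      using f unfolding monoid_alg_simps(1) mem_Collect_eq
    proof (induction f rule: keys_subset_induct)
      case zero
      then show ?case using g c by simp
    next
      case (single_add l d f)
      then have "f \<in> carrier (monoid_alg G)" by (simp add: monoid_alg_simps)
      with single_add g 1 \<phi> show ?case
        by (simp add: monoid_alg_mult_add_left add s c l_distr)
    qed
  qed
qed

end

section \<open>Quotients by two-sided ideals and maps that descend to them\<close>

locale quotient_algebra = complex_algebra A + ideal I A for A (structure) and I
begin

abbreviation proj where "proj x \<equiv> I +> x"

text \<open>Since s x = (s 1) x, a ring ideal of a unital algebra is automatically a linear
  subspace. Hence ideals in the ring-theoretic sense suffice for quotient algebras.\<close>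

lemma ideal_smult: "x \<in> I \<Longrightarrow> s \<odot> x \<in> I"
  using I_l_closed[of x "s \<odot> \<one>"] smult_mult_left[of \<one> x s] a_Hcarr by simp

lemma proj_add_ideal: "\<lbrakk>i \<in> I; x \<in> carrier A\<rbrakk> \<Longrightarrow> proj (i \<oplus> x) = proj x"
  by (rule a_repr_independence'[symmetric]) (auto simp: a_r_coset_def')

lemma proj_ideal: "x \<in> I \<Longrightarrow> proj x = proj \<zero>"
  by (metis a_rcos_const additive_subgroup.zero_closed is_additive_subgroup)

lemma quot_alg_carrier: "carrier (quot_alg A I) = proj ` carrier A"
  by (auto simp: quot_alg_def FactRing_def A_RCOSETS_def')

lemma quot_alg_simps:
  "\<lbrakk>x \<in> carrier A; y \<in> carrier A\<rbrakk> \<Longrightarrow> proj x \<oplus>\<^bsub>quot_alg A I\<^esub> proj y = proj (x \<oplus> y)"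
  "\<lbrakk>x \<in> carrier A; y \<in> carrier A\<rbrakk> \<Longrightarrow> proj x \<otimes>\<^bsub>quot_alg A I\<^esub> proj y = proj (x \<otimes> y)"
  "\<one>\<^bsub>quot_alg A I\<^esub> = proj \<one>" "\<zero>\<^bsub>quot_alg A I\<^esub> = proj \<zero>"
  by (simp_all add: quot_alg_def FactRing_def a_rcos_sum rcoset_mult_add
    a_rcos_const[OF additive_subgroup.zero_closed[OF is_additive_subgroup]])

lemma quot_alg_smult:
  assumes "x \<in> carrier A"
  shows "s \<odot>\<^bsub>quot_alg A I\<^esub> proj x = proj (s \<odot> x)"
proof -
  have "proj (s \<odot> y) = proj (s \<odot> x)" if "y \<in> proj x" for y
  proof -
    from that obtain i where i: "i \<in> I" "y = i \<oplus> x" by (auto simp: a_r_coset_def')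
    then have "s \<odot> y = s \<odot> i \<oplus> s \<odot> x"
      using assms a_Hcarr by (simp add: smult_add_right)
    then show ?thesis using i assms by (simp add: ideal_smult proj_add_ideal)
  qed
  moreover have "x \<in> proj x" using assms by (rule a_rcos_self)
  ultimately have "(\<Union>y\<in>proj x. proj (s \<odot> y)) = proj (s \<odot> x)" by blast
  then show ?thesis by (simp add: quot_alg_def)
qed

lemma complex_algebra_quot_alg: "complex_algebra (quot_alg A I)"
  by (rule complex_algebraI)
    (auto simp: quot_alg_carrier quot_alg_simps quot_alg_smult a_ac m_assoc l_distr r_distr
      smult_add_left smult_add_right smult_smult smult_mult_left smult_mult_right)

lemma proj_alg_hom: "(\<lambda>x. proj x) \<in> alg_hom A (quot_alg A I)"
  by (intro alg_homI lin_homI) (auto simp: quot_alg_carrier quot_alg_simps quot_alg_smult)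

end

lemma (in complex_algebra) quotient_algebraI: "ideal I A \<Longrightarrow> quotient_algebra A I"
  by (simp add: quotient_algebra_def complex_algebra_axioms)

text \<open>Only linearity and vanishing on I are asked for, so the same lemma covers presented
  algebras, where I is generated by relations, and tensor products, where I is the span of the
  bilinearity relations.\<close>

lemma coset_ext_proj:
  assumes "complex_algebra B" "quotient_algebra A I"
    and hom: "lin_ext B \<phi> \<in> lin_hom A B"
    and I: "\<And>x. x \<in> I \<Longrightarrow> lin_ext B \<phi> x = \<zero>\<^bsub>B\<^esub>"
    and f: "f \<in> carrier A"
  shows "coset_ext B \<phi> (I +>\<^bsub>A\<^esub> f) = lin_ext B \<phi> f"
proof -
  interpret B: complex_algebra B by fact
  interpret quotient_algebra A I by fact
  have "lin_ext B \<phi> ` (I +>\<^bsub>A\<^esub> f) = {lin_ext B \<phi> f}"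
  proof -
    have "lin_ext B \<phi> g = lin_ext B \<phi> f" if g: "g \<in> I +>\<^bsub>A\<^esub> f" for g
    proof -
      from g obtain i where "i \<in> I" "g = i \<oplus>\<^bsub>A\<^esub> f" by (auto simp: a_r_coset_def')
      then show ?thesis using f I lin_hom_closed[OF hom f]
        by (simp add: lin_hom_add[OF hom] a_Hcarr)
    qed
    moreover have "f \<in> I +>\<^bsub>A\<^esub> f" using f by (rule a_rcos_self)
    ultimately show ?thesis by blast
  qed
  then show ?thesis by (simp add: coset_ext_def)
qed

lemma coset_ext_lin_hom:
  assumes "complex_algebra B" "quotient_algebra A I"
    and hom: "lin_ext B \<phi> \<in> lin_hom A B"
    and I: "\<And>x. x \<in> I \<Longrightarrow> lin_ext B \<phi> x = \<zero>\<^bsub>B\<^esub>"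
  shows "coset_ext B \<phi> \<in> lin_hom (quot_alg A I) B"
proof -
  interpret quotient_algebra A I by fact
  note [simp] = coset_ext_proj[OF assms] quot_alg_simps quot_alg_smult
  show ?thesis
    by (rule lin_homI) (auto simp: quot_alg_carrier lin_homD[OF hom])
qed

section \<open>Presented algebras\<close>

definition word_prod :: "(complex, 'b, 'n) module_scheme \<Rightarrow> ('g \<Rightarrow> 'b) \<Rightarrow> 'g list \<Rightarrow> 'b" where
  "word_prod B v w = foldr (\<lambda>g z. v g \<otimes>\<^bsub>B\<^esub> z) w \<one>\<^bsub>B\<^esub>"

lemma word_prod_simps [simp]:
  "word_prod B v [] = \<one>\<^bsub>B\<^esub>" "word_prod B v (g # w) = v g \<otimes>\<^bsub>B\<^esub> word_prod B v w"
  by (simp_all add: word_prod_def)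

lemma pres_lift_eq: "pres_lift B v = coset_ext B (word_prod B v)"
  by (simp add: pres_lift_def word_prod_def[abs_def])

lemma free_monoid_simps:
  "carrier free_monoid = UNIV" "mult free_monoid = (@)" "one free_monoid = []"
  by (simp_all add: free_monoid_def)

lemma monoid_free_monoid: "monoid free_monoid"
  by (rule monoidI) (auto simp: free_monoid_simps)

lemma complex_algebra_free_alg: "complex_algebra free_alg"
  unfolding free_alg_def by (rule complex_algebra_monoid_alg) (rule monoid_free_monoid)

lemma carrier_free_alg: "carrier free_alg = UNIV"
  by (simp add: free_alg_def monoid_alg_simps free_monoid_simps)

lemma quotient_algebra_pres: "quotient_algebra free_alg (Idl\<^bsub>free_alg\<^esub> Rels)"
proof -
  interpret complex_algebra free_alg by (rule complex_algebra_free_alg)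
  show ?thesis by (rule quotient_algebraI, rule genideal_ideal) (simp add: carrier_free_alg)
qed

lemma complex_algebra_pres_alg: "complex_algebra (pres_alg Rels)"
  unfolding pres_alg_def by (rule quotient_algebra.complex_algebra_quot_alg[OF quotient_algebra_pres])

lemma pres_gen_closed [simp]: "pres_gen Rels g \<in> carrier (pres_alg Rels)"
  by (simp add: pres_gen_def pres_alg_def quotient_algebra.quot_alg_carrier[OF quotient_algebra_pres]
      carrier_free_alg)

context complex_algebra
begin

lemma word_prod_closed: "\<forall>g. v g \<in> carrier A \<Longrightarrow> word_prod A v w \<in> carrier A"
  by (induction w) auto

lemma word_prod_append:
  "\<forall>g. v g \<in> carrier A \<Longrightarrow> word_prod A v (w @ w') = word_prod A v w \<otimes> word_prod A v w'"
  by (induction w) (auto simp: word_prod_closed m_assoc)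

lemma word_eval_alg_hom:
  assumes "\<forall>g. v g \<in> carrier A"
  shows "lin_ext A (word_prod A v) \<in> alg_hom free_alg A"
  unfolding free_alg_def
  by (rule lin_ext_alg_hom[OF monoid_free_monoid])
    (simp_all add: free_monoid_simps assms word_prod_closed word_prod_append)

lemma word_eval_add:
  assumes "\<forall>g. v g \<in> carrier A"
  shows "lin_ext A (word_prod A v) (f + f') = lin_ext A (word_prod A v) f \<oplus> lin_ext A (word_prod A v) f'"
  using alg_hom_add[OF word_eval_alg_hom[OF assms], of f f'] by (simp add: carrier_free_alg)
    (simp add: free_alg_def monoid_alg_simps)

lemma word_eval_smult:
  assumes "\<forall>g. v g \<in> carrier A"
  shows "lin_ext A (word_prod A v) (Poly_Mapping.map ((*) s) f) = s \<odot> lin_ext A (word_prod A v) f"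
  using alg_hom_smult[OF word_eval_alg_hom[OF assms], of f s] by (simp add: carrier_free_alg)
    (simp add: free_alg_def monoid_alg_simps)

lemma word_eval_diff:
  assumes "\<forall>g. v g \<in> carrier A"
  shows "lin_ext A (word_prod A v) (f - f')
    = lin_ext A (word_prod A v) f \<oplus> (- 1) \<odot> lin_ext A (word_prod A v) f'"
  using word_eval_add[OF assms, of f "- f'"] word_eval_smult[OF assms, of "- 1" f']
  by (simp add: map_mult_uminus)

lemma word_eval_single:
  "\<forall>g. v g \<in> carrier A \<Longrightarrow>
    lin_ext A (word_prod A v) (Poly_Mapping.single w c) = c \<odot> word_prod A v w"
  by (rule lin_ext_single) (rule word_prod_closed)

text \<open>Evaluation of words is a ring homomorphism, so its kernel is an ideal; containing the
  relations, it contains the ideal they generate.\<close>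

lemma word_eval_ideal:
  assumes v: "\<forall>g. v g \<in> carrier A"
    and rels: "\<forall>x\<in>Rels. lin_ext A (word_prod A v) x = \<zero>"
    and x: "x \<in> Idl\<^bsub>free_alg\<^esub> Rels"
  shows "lin_ext A (word_prod A v) x = \<zero>"
proof -
  interpret F: complex_algebra free_alg by (rule complex_algebra_free_alg)
  interpret h: ring_hom_ring free_alg A "lin_ext A (word_prod A v)"
    by (rule ring_hom_ringI2) (use word_eval_alg_hom[OF v] in \<open>auto simp: alg_hom_def
      F.ring_axioms ring_axioms\<close>)
  have "Idl\<^bsub>free_alg\<^esub> Rels \<subseteq> a_kernel free_alg A (lin_ext A (word_prod A v))"
    by (rule F.genideal_minimal[OF h.kernel_is_ideal])
      (use rels in \<open>unfold a_kernel_def' carrier_free_alg, blast\<close>)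
  with x show ?thesis unfolding a_kernel_def' by blast
qed

end

lemma pres_lift_proj:
  assumes "complex_algebra B" "\<forall>g. v g \<in> carrier B"
    and "\<forall>x\<in>Rels. lin_ext B (word_prod B v) x = \<zero>\<^bsub>B\<^esub>"
  shows "pres_lift B v (Idl\<^bsub>free_alg\<^esub> Rels +>\<^bsub>free_alg\<^esub> f) = lin_ext B (word_prod B v) f"
  unfolding pres_lift_eq
  by (rule coset_ext_proj[OF assms(1) quotient_algebra_pres])
    (use alg_hom_lin[OF complex_algebra.word_eval_alg_hom[OF assms(1,2)]]
      complex_algebra.word_eval_ideal[OF assms] in \<open>auto simp: carrier_free_alg\<close>)

lemma pres_lift_gen:
  assumes "complex_algebra B" "\<forall>g. v g \<in> carrier B"
    and "\<forall>x\<in>Rels. lin_ext B (word_prod B v) x = \<zero>\<^bsub>B\<^esub>"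
  shows "pres_lift B v (pres_gen Rels g) = v g"
proof -
  interpret complex_algebra B by fact
  show ?thesis
    using assms(2) unfolding pres_gen_def by (subst pres_lift_proj[OF assms]) (auto simp: word_eval_single)
qed

lemma pres_lift_alg_hom:
  assumes "complex_algebra B" "\<forall>g. v g \<in> carrier B"
    and "\<forall>x\<in>Rels. lin_ext B (word_prod B v) x = \<zero>\<^bsub>B\<^esub>"
  shows "pres_lift B v \<in> alg_hom (pres_alg Rels) B"
proof -
  interpret complex_algebra B by fact
  interpret Q: quotient_algebra free_alg "Idl\<^bsub>free_alg\<^esub> Rels" by (rule quotient_algebra_pres)
  note hom = word_eval_alg_hom[OF assms(2)]
  note [simp] = pres_lift_proj[OF assms]
  show ?thesis
    unfolding pres_alg_def
    by (intro alg_homI lin_homI)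
      (auto simp: Q.quot_alg_carrier Q.quot_alg_simps Q.quot_alg_smult alg_homD[OF hom])
qed

text \<open>Words in the generators span the algebra. The rule is meant for properties that are not
  equalities of two homomorphisms, the antipode identities above all.\<close>

lemma pres_induct [consumes 1, case_names one gen add mult smult]:
  assumes "x \<in> carrier (pres_alg Rels)"
    and one: "P \<one>\<^bsub>pres_alg Rels\<^esub>" and gen: "\<And>g. P (pres_gen Rels g)"
    and add: "\<And>x y. \<lbrakk>x \<in> carrier (pres_alg Rels); y \<in> carrier (pres_alg Rels); P x; P y\<rbrakk>
      \<Longrightarrow> P (x \<oplus>\<^bsub>pres_alg Rels\<^esub> y)"
    and mult: "\<And>x y. \<lbrakk>x \<in> carrier (pres_alg Rels); y \<in> carrier (pres_alg Rels); P x; P y\<rbrakk>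
      \<Longrightarrow> P (x \<otimes>\<^bsub>pres_alg Rels\<^esub> y)"
    and smult: "\<And>s x. \<lbrakk>x \<in> carrier (pres_alg Rels); P x\<rbrakk> \<Longrightarrow> P (s \<odot>\<^bsub>pres_alg Rels\<^esub> x)"
  shows "P x"
proof -
  interpret Q: quotient_algebra free_alg "Idl\<^bsub>free_alg\<^esub> Rels" by (rule quotient_algebra_pres)
  interpret complex_algebra "pres_alg Rels" by (rule complex_algebra_pres_alg)
  note defs = pres_alg_def[of Rels]
  have [simp]: "Q.proj f \<in> carrier (pres_alg Rels)" for f
    by (simp add: defs Q.quot_alg_carrier carrier_free_alg)
  have w: "P (Q.proj (Poly_Mapping.single w 1))" for w
  proof (induction w)
    case Nil
    then show ?case
      using one by (simp add: defs Q.quot_alg_simps)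
        (simp add: free_alg_def monoid_alg_simps free_monoid_simps)
  next
    case (Cons g w)
    have "Q.proj (Poly_Mapping.single (g # w) 1)
        = pres_gen Rels g \<otimes>\<^bsub>pres_alg Rels\<^esub> Q.proj (Poly_Mapping.single w 1)"
      unfolding defs pres_gen_def
      by (subst Q.quot_alg_simps)
        (simp_all add: carrier_free_alg, simp add: free_alg_def monoid_alg_mult_single free_monoid_simps)
    then show ?case using mult[OF _ _ gen Cons] by simp
  qed
  have "P (Q.proj f)" for f
  proof -
    have s: "P (Q.proj (Poly_Mapping.single w c))" for w c
    proof -
      have "Q.proj (Poly_Mapping.single w c) = c \<odot>\<^bsub>pres_alg Rels\<^esub> Q.proj (Poly_Mapping.single w 1)"
        unfolding defs
        by (subst Q.quot_alg_smult)
          (simp_all add: carrier_free_alg, simp add: free_alg_def monoid_alg_simps)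
      then show ?thesis using smult w by simp
    qed
    have "Poly_Mapping.keys f \<subseteq> UNIV" by simp
    then show ?thesis
    proof (induction f rule: keys_subset_induct)
      case zero
      then show ?case using s[of "[]" 0] by simp
    next
      case (single_add k c g)
      have "Q.proj (Poly_Mapping.single k c + g)
          = Q.proj (Poly_Mapping.single k c) \<oplus>\<^bsub>pres_alg Rels\<^esub> Q.proj g"
        unfolding defs
        by (subst Q.quot_alg_simps)
          (simp_all add: carrier_free_alg, simp add: free_alg_def monoid_alg_simps)
      then show ?case using add[OF _ _ s single_add(3)] by simp
    qed
  qed
  then show ?thesis
    using assms(1) by (auto simp: defs Q.quot_alg_carrier)
qed

text \<open>This is what turns coassociativity and the counit axioms into finitely many
  checks.\<close>

lemma pres_hom_eqI:
  assumes f: "f \<in> alg_hom (pres_alg Rels) B" and h: "h \<in> alg_hom (pres_alg Rels) B"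
    and "\<And>g. f (pres_gen Rels g) = h (pres_gen Rels g)"
    and "x \<in> carrier (pres_alg Rels)"
  shows "f x = h x"
  using assms(4)
  by (induction x rule: pres_induct) (simp_all add: assms(3) alg_homD[OF f] alg_homD[OF h])

text \<open>Evaluation at the generators themselves is the quotient projection, because both are
  linear and multiplicative and agree on letters. Membership of a relation in the ideal thereby
  becomes an identity between products of generators.\<close>

lemma pres_eval_gen:
  "lin_ext (pres_alg Rels) (word_prod (pres_alg Rels) (pres_gen Rels)) f
    = Idl\<^bsub>free_alg\<^esub> Rels +>\<^bsub>free_alg\<^esub> f"
proof -
  interpret Q: quotient_algebra free_alg "Idl\<^bsub>free_alg\<^esub> Rels" by (rule quotient_algebra_pres)
  interpret complex_algebra "pres_alg Rels" by (rule complex_algebra_pres_alg)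
  note p = Q.proj_alg_hom[folded pres_alg_def]
  have w: "word_prod (pres_alg Rels) (pres_gen Rels) w = Q.proj (Poly_Mapping.single w 1)" for w
  proof (induction w)
    case Nil
    then show ?case using alg_hom_one[OF p]
      by (simp add: free_alg_def monoid_alg_simps free_monoid_simps)
  next
    case (Cons g w)
    have "Poly_Mapping.single (g # w) 1
        = Poly_Mapping.single [g] 1 \<otimes>\<^bsub>free_alg\<^esub> Poly_Mapping.single w 1"
      by (simp add: free_alg_def monoid_alg_mult_single free_monoid_simps)
    then show ?case
      using Cons alg_hom_mult[OF p, of "Poly_Mapping.single [g] 1" "Poly_Mapping.single w 1"]
      by (simp add: carrier_free_alg pres_gen_def)
  qed
  have "Poly_Mapping.keys f \<subseteq> UNIV" by simp
  then show ?thesis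
  proof (induction f rule: keys_subset_induct)
    case zero
    then show ?case
      using lin_hom_zero[OF Q.complex_algebra_axioms complex_algebra_axioms alg_hom_lin[OF p]]
      by (simp add: free_alg_def monoid_alg_simps)
  next
    case (single_add k c f)
    have "Q.proj (Poly_Mapping.single k c + f)
        = Q.proj (Poly_Mapping.single k c) \<oplus>\<^bsub>pres_alg Rels\<^esub> Q.proj f"
      using alg_hom_add[OF p, of "Poly_Mapping.single k c" f]
      by (simp add: carrier_free_alg) (simp add: free_alg_def monoid_alg_simps)
    moreover have "Q.proj (Poly_Mapping.single k c)
        = c \<odot>\<^bsub>pres_alg Rels\<^esub> Q.proj (Poly_Mapping.single k 1)"
      using alg_hom_smult[OF p, of "Poly_Mapping.single k 1" c]
      by (simp add: carrier_free_alg) (simp add: free_alg_def monoid_alg_simps)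
    moreover have "lin_ext (pres_alg Rels) (word_prod (pres_alg Rels) (pres_gen Rels))
        (Poly_Mapping.single k c + f)
      = c \<odot>\<^bsub>pres_alg Rels\<^esub> word_prod (pres_alg Rels) (pres_gen Rels) k \<oplus>\<^bsub>pres_alg Rels\<^esub>
        lin_ext (pres_alg Rels) (word_prod (pres_alg Rels) (pres_gen Rels)) f"
      by (simp add: word_eval_add word_eval_single)
    ultimately show ?case
      by (simp only: w[of k] single_add(3))
  qed
qed

lemma pres_rel:
  assumes "x \<in> Rels"
  shows "lin_ext (pres_alg Rels) (word_prod (pres_alg Rels) (pres_gen Rels)) x = \<zero>\<^bsub>pres_alg Rels\<^esub>"
proof -
  interpret Q: quotient_algebra free_alg "Idl\<^bsub>free_alg\<^esub> Rels" by (rule quotient_algebra_pres)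
  have "x \<in> Idl\<^bsub>free_alg\<^esub> Rels"
    using Q.genideal_self[of Rels] assms unfolding carrier_free_alg by blast
  then have "Q.proj x = \<zero>\<^bsub>pres_alg Rels\<^esub>"
    unfolding pres_alg_def Q.quot_alg_simps by (rule Q.proj_ideal)
  then show ?thesis
    unfolding pres_eval_gen .
qed

section \<open>Tensor products\<close>

lemma lin_span_least: "\<lbrakk>submodule N complex_alg M; S \<subseteq> N; f \<in> lin_span M S\<rbrakk> \<Longrightarrow> f \<in> N"
  by (auto simp: lin_span_def)

lemma lin_span_base: "f \<in> S \<Longrightarrow> f \<in> lin_span M S"
  by (auto simp: lin_span_def)

lemma (in complex_algebra) submodule_zero: "submodule N complex_alg A \<Longrightarrow> \<zero> \<in> N"
  by (drule submodule.axioms(1), drule subgroup.one_closed) simp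

lemma (in complex_algebra) submodule_smult:
  "\<lbrakk>submodule N complex_alg A; x \<in> N\<rbrakk> \<Longrightarrow> s \<odot> x \<in> N"
  using submoduleE(4)[of N s x] by simp

lemma (in complex_algebra) submodule_lin_span:
  assumes "S \<subseteq> carrier A"
  shows "submodule (lin_span A S) complex_alg A"
proof (rule submoduleI)
  show "lin_span A S \<subseteq> carrier A"
    using lin_span_least[OF carrier_is_submodule assms] by blast
  show "\<zero> \<in> lin_span A S"
    unfolding lin_span_def
    by (auto dest: submodule_zero)
qed (auto simp: lin_span_def intro: submodule_smult dest: submoduleE)

text \<open>The preimage of a submodule is a submodule. With the span of the bilinearity relations
  as target it shows that span stable under multiplication; with the zero submodule as target it
  shows that bilinear maps descend.\<close>

lemma lin_hom_lin_span:
  assumes "complex_algebra M" "complex_algebra M'" and h: "h \<in> lin_hom M M'"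
    and N: "submodule N complex_alg M'" and S: "S \<subseteq> carrier M" "\<And>f. f \<in> S \<Longrightarrow> h f \<in> N"
    and f: "f \<in> lin_span M S"
  shows "h f \<in> N"
proof -
  interpret M: complex_algebra M by fact
  interpret M': complex_algebra M' by fact
  have "submodule {f \<in> carrier M. h f \<in> N} complex_alg M"
  proof (rule M.submoduleI)
    have "\<zero>\<^bsub>M'\<^esub> \<in> N"
      using subgroup.one_closed[OF submodule.axioms(1)[OF N]] by simp
    then show "\<zero>\<^bsub>M\<^esub> \<in> {f \<in> carrier M. h f \<in> N}"
      using lin_hom_zero[OF assms(1-3)] by simp
  qed (use M'.submoduleE[OF N] in \<open>auto simp: lin_homD[OF h] M.a_inv_eq_smult\<close>)
  then show ?thesis
    using lin_span_least[OF _ _ f] S by blast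
qed

definition bilinear_map ::
  "(complex, 'a, 'l) module_scheme \<Rightarrow> (complex, 'b, 'm) module_scheme
    \<Rightarrow> (complex, 'c, 'n) module_scheme \<Rightarrow> ('a \<Rightarrow> 'b \<Rightarrow> 'c) \<Rightarrow> bool" where
  "bilinear_map A B P \<beta> \<longleftrightarrow>
     (\<forall>y\<in>carrier B. (\<lambda>x. \<beta> x y) \<in> lin_hom A P) \<and> (\<forall>x\<in>carrier A. \<beta> x \<in> lin_hom B P)"

lemma bilinear_mapI:
  assumes "\<And>x y. \<lbrakk>x \<in> carrier A; y \<in> carrier B\<rbrakk> \<Longrightarrow> \<beta> x y \<in> carrier P"
    and "\<And>x x' y. \<lbrakk>x \<in> carrier A; x' \<in> carrier A; y \<in> carrier B\<rbrakk>
      \<Longrightarrow> \<beta> (x \<oplus>\<^bsub>A\<^esub> x') y = \<beta> x y \<oplus>\<^bsub>P\<^esub> \<beta> x' y"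
    and "\<And>x y y'. \<lbrakk>x \<in> carrier A; y \<in> carrier B; y' \<in> carrier B\<rbrakk>
      \<Longrightarrow> \<beta> x (y \<oplus>\<^bsub>B\<^esub> y') = \<beta> x y \<oplus>\<^bsub>P\<^esub> \<beta> x y'"
    and "\<And>s x y. \<lbrakk>x \<in> carrier A; y \<in> carrier B\<rbrakk> \<Longrightarrow> \<beta> (s \<odot>\<^bsub>A\<^esub> x) y = s \<odot>\<^bsub>P\<^esub> \<beta> x y"
    and "\<And>s x y. \<lbrakk>x \<in> carrier A; y \<in> carrier B\<rbrakk> \<Longrightarrow> \<beta> x (s \<odot>\<^bsub>B\<^esub> y) = s \<odot>\<^bsub>P\<^esub> \<beta> x y"
  shows "bilinear_map A B P \<beta>"
  using assms by (auto simp: bilinear_map_def intro!: lin_homI)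

lemma bilinear_mapD:
  assumes "bilinear_map A B P \<beta>" "x \<in> carrier A" "y \<in> carrier B"
  shows "\<beta> x y \<in> carrier P"
    and "x' \<in> carrier A \<Longrightarrow> \<beta> (x \<oplus>\<^bsub>A\<^esub> x') y = \<beta> x y \<oplus>\<^bsub>P\<^esub> \<beta> x' y"
    and "y' \<in> carrier B \<Longrightarrow> \<beta> x (y \<oplus>\<^bsub>B\<^esub> y') = \<beta> x y \<oplus>\<^bsub>P\<^esub> \<beta> x y'"
    and "\<beta> (s \<odot>\<^bsub>A\<^esub> x) y = s \<odot>\<^bsub>P\<^esub> \<beta> x y"
    and "\<beta> x (s \<odot>\<^bsub>B\<^esub> y) = s \<odot>\<^bsub>P\<^esub> \<beta> x y"
  using assms by (auto simp: bilinear_map_def lin_hom_def)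

lemma bilinear_relsI:
  "\<lbrakk>x \<in> carrier A; x' \<in> carrier A; y \<in> carrier B\<rbrakk> \<Longrightarrow>
    Poly_Mapping.single (x \<oplus>\<^bsub>A\<^esub> x', y) 1 - Poly_Mapping.single (x, y) 1
      - Poly_Mapping.single (x', y) 1 \<in> bilinear_rels A B"
  "\<lbrakk>x \<in> carrier A; y \<in> carrier B; y' \<in> carrier B\<rbrakk> \<Longrightarrow>
    Poly_Mapping.single (x, y \<oplus>\<^bsub>B\<^esub> y') 1 - Poly_Mapping.single (x, y) 1
      - Poly_Mapping.single (x, y') 1 \<in> bilinear_rels A B"
  "\<lbrakk>x \<in> carrier A; y \<in> carrier B\<rbrakk> \<Longrightarrow>
    Poly_Mapping.single (s \<odot>\<^bsub>A\<^esub> x, y) 1 - Poly_Mapping.single (x, y) s \<in> bilinear_rels A B"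
  "\<lbrakk>x \<in> carrier A; y \<in> carrier B\<rbrakk> \<Longrightarrow>
    Poly_Mapping.single (x, s \<odot>\<^bsub>B\<^esub> y) 1 - Poly_Mapping.single (x, y) s \<in> bilinear_rels A B"
  unfolding bilinear_rels_def by blast+

lemma bilinear_rels_cases:
  assumes "f \<in> bilinear_rels A B"
  obtains (add_left) x x' y where "x \<in> carrier A" "x' \<in> carrier A" "y \<in> carrier B"
      "f = Poly_Mapping.single (x \<oplus>\<^bsub>A\<^esub> x', y) 1 - Poly_Mapping.single (x, y) 1
        - Poly_Mapping.single (x', y) 1"
    | (add_right) x y y' where "x \<in> carrier A" "y \<in> carrier B" "y' \<in> carrier B"
      "f = Poly_Mapping.single (x, y \<oplus>\<^bsub>B\<^esub> y') 1 - Poly_Mapping.single (x, y) 1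
        - Poly_Mapping.single (x, y') 1"
    | (smult_left) s x y where "x \<in> carrier A" "y \<in> carrier B"
      "f = Poly_Mapping.single (s \<odot>\<^bsub>A\<^esub> x, y) 1 - Poly_Mapping.single (x, y) s"
    | (smult_right) s x y where "x \<in> carrier A" "y \<in> carrier B"
      "f = Poly_Mapping.single (x, s \<odot>\<^bsub>B\<^esub> y) 1 - Poly_Mapping.single (x, y) s"
  using assms unfolding bilinear_rels_def by blast

section \<open>The tensor product of two algebras and its universal property\<close>

locale tensor_product = A: complex_algebra A + B: complex_algebra B
  for A :: "(complex, 'a, 'm) module_scheme" and B :: "(complex, 'b, 'n) module_scheme"
begin

lemma monoid_prod: "monoid (A \<times>\<times> B)"
  by (rule DirProd_monoid) unfold_locales

sublocale M: complex_algebra "monoid_alg (A \<times>\<times> B)"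
  by (rule complex_algebra_monoid_alg) (rule monoid_prod)

abbreviation formal :: "'a \<Rightarrow> 'b \<Rightarrow> ('a \<times> 'b \<Rightarrow>\<^sub>0 complex)" where
  "formal x y \<equiv> Poly_Mapping.single (x, y) 1"

lemma single_carrier:
  "\<lbrakk>x \<in> carrier A; y \<in> carrier B\<rbrakk> \<Longrightarrow> Poly_Mapping.single (x, y) c \<in> carrier (monoid_alg (A \<times>\<times> B))"
  by (simp add: monoid_alg_simps)

lemma diff_carrier:
  "\<lbrakk>f \<in> carrier (monoid_alg G); g \<in> carrier (monoid_alg G)\<rbrakk> \<Longrightarrow> f - g \<in> carrier (monoid_alg G)"
  using keys_diff_subset[of f g] by (auto simp: monoid_alg_simps)

lemma bilinear_rels_carrier: "bilinear_rels A B \<subseteq> carrier (monoid_alg (A \<times>\<times> B))"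
proof
  fix f assume "f \<in> bilinear_rels A B"
  then show "f \<in> carrier (monoid_alg (A \<times>\<times> B))"
    by (cases rule: bilinear_rels_cases) (simp_all add: diff_carrier single_carrier)
qed

lemma submodule_tensor_rels: "submodule (tensor_rels A B) complex_alg (monoid_alg (A \<times>\<times> B))"
  unfolding tensor_rels_def by (rule M.submodule_lin_span) (rule bilinear_rels_carrier)

lemma mult_bilinear_rels:
  assumes f: "f \<in> bilinear_rels A B" and uv: "u \<in> carrier A" "v \<in> carrier B"
  shows "formal u v \<otimes>\<^bsub>monoid_alg (A \<times>\<times> B)\<^esub> f \<in> bilinear_rels A B"
    and "f \<otimes>\<^bsub>monoid_alg (A \<times>\<times> B)\<^esub> formal u v \<in> bilinear_rels A B"
  using f
  by (cases rule: bilinear_rels_cases;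
      simp add: monoid_alg_mult_diff monoid_alg_mult_single A.l_distr A.r_distr B.l_distr B.r_distr
        A.smult_mult_left A.smult_mult_right B.smult_mult_left B.smult_mult_right uv bilinear_relsI)+

text \<open>Two reductions by linearity. For a fixed pure tensor, multiplication is linear in f, so
  it is enough to treat the bilinearity relations themselves; then g is a finite combination of pure
  tensors.\<close>

lemma mult_tensor_rels:
  assumes f: "f \<in> tensor_rels A B" and g: "g \<in> carrier (monoid_alg (A \<times>\<times> B))"
  shows "g \<otimes>\<^bsub>monoid_alg (A \<times>\<times> B)\<^esub> f \<in> tensor_rels A B"
    and "f \<otimes>\<^bsub>monoid_alg (A \<times>\<times> B)\<^esub> g \<in> tensor_rels A B"
proof -
  let ?M = "monoid_alg (A \<times>\<times> B)" and ?K = "tensor_rels A B"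
  note K = M.submoduleE[OF submodule_tensor_rels]
  have K0: "0 \<in> ?K"
    using subgroup.one_closed[OF submodule.axioms(1)[OF submodule_tensor_rels]]
    by (simp add: monoid_alg_simps)
  have Kadd: "h + h' \<in> ?K" if "h \<in> ?K" "h' \<in> ?K" for h h'
    using K(5)[OF that] by (simp add: monoid_alg_simps)
  have Ksm: "Poly_Mapping.map ((*) s) h \<in> ?K" if "h \<in> ?K" for s h
    using K(4)[OF _ that, of s] by (simp add: monoid_alg_simps)
  have 1: "formal u v \<otimes>\<^bsub>?M\<^esub> f \<in> ?K" "f \<otimes>\<^bsub>?M\<^esub> formal u v \<in> ?K"
    if uv: "u \<in> carrier A" "v \<in> carrier B" for u v
  proof -
    have "(\<lambda>f. formal u v \<otimes>\<^bsub>?M\<^esub> f) \<in> lin_hom ?M ?M" "(\<lambda>f. f \<otimes>\<^bsub>?M\<^esub> formal u v) \<in> lin_hom ?M ?M"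
      using single_carrier[OF uv]
      by (auto intro!: lin_homI simp: M.l_distr M.r_distr M.smult_mult_left M.smult_mult_right)
    from this[THEN lin_hom_lin_span[OF M.complex_algebra_axioms M.complex_algebra_axioms _
          submodule_tensor_rels bilinear_rels_carrier _ f[unfolded tensor_rels_def]]]
      mult_bilinear_rels[OF _ uv]
    show "formal u v \<otimes>\<^bsub>?M\<^esub> f \<in> ?K" "f \<otimes>\<^bsub>?M\<^esub> formal u v \<in> ?K"
      by (auto simp: tensor_rels_def intro: lin_span_base)
  qed
  have 2: "Poly_Mapping.single k c \<otimes>\<^bsub>?M\<^esub> f \<in> ?K" "f \<otimes>\<^bsub>?M\<^esub> Poly_Mapping.single k c \<in> ?K"
    if "k \<in> carrier (A \<times>\<times> B)" for k c
  proof -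
    obtain u v where k: "k = (u, v)" "u \<in> carrier A" "v \<in> carrier B" using \<open>k \<in> _\<close> by auto
    have "Poly_Mapping.single k c \<otimes>\<^bsub>?M\<^esub> f = Poly_Mapping.map ((*) c) (formal u v \<otimes>\<^bsub>?M\<^esub> f)"
      "f \<otimes>\<^bsub>?M\<^esub> Poly_Mapping.single k c = Poly_Mapping.map ((*) c) (f \<otimes>\<^bsub>?M\<^esub> formal u v)"
      using k by (simp add: monoid_alg_mult_smult(1)[symmetric],
        simp add: monoid_alg_mult_smult(2)[symmetric])
    then show "Poly_Mapping.single k c \<otimes>\<^bsub>?M\<^esub> f \<in> ?K" "f \<otimes>\<^bsub>?M\<^esub> Poly_Mapping.single k c \<in> ?K"
      using 1 k Ksm by simp_all
  qed
  show "g \<otimes>\<^bsub>?M\<^esub> f \<in> ?K" "f \<otimes>\<^bsub>?M\<^esub> g \<in> ?K"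
    using g unfolding monoid_alg_simps(1) mem_Collect_eq
    by (induction g rule: keys_subset_induct)
      (simp_all add: K0 2 Kadd monoid_alg_mult_add_left monoid_alg_mult_add_right)
qed

sublocale Q: quotient_algebra "monoid_alg (A \<times>\<times> B)" "tensor_rels A B"
  by (rule M.quotient_algebraI, rule idealI)
    (use submodule.axioms(1)[OF submodule_tensor_rels] mult_tensor_rels M.ring_axioms in auto)

sublocale T: complex_algebra "tensor_alg A B"
  unfolding tensor_alg_def by (rule Q.complex_algebra_quot_alg)

lemma tensor_closed [simp, intro]:
  "\<lbrakk>x \<in> carrier A; y \<in> carrier B\<rbrakk> \<Longrightarrow> tensor A B x y \<in> carrier (tensor_alg A B)"
  by (simp add: tensor_def tensor_alg_def Q.quot_alg_carrier single_carrier)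

lemma proj_diff_eq:
  assumes "f - g \<in> tensor_rels A B" "g \<in> carrier (monoid_alg (A \<times>\<times> B))"
  shows "Q.proj f = Q.proj g"
  using Q.proj_add_ideal[OF assms] by (simp add: monoid_alg_simps)

lemma bilinear_map_tensor: "bilinear_map A B (tensor_alg A B) (tensor A B)"
proof (rule bilinear_mapI)
  have *: "f \<in> tensor_rels A B" if "f \<in> bilinear_rels A B" for f
    using that by (simp add: tensor_rels_def lin_span_base)
  note simps = tensor_def tensor_alg_def Q.quot_alg_simps Q.quot_alg_smult single_carrier
    monoid_alg_simps(4,5)
  note c = single_carrier M.add.m_closed[unfolded monoid_alg_simps(4)]
  show "tensor A B (x \<oplus>\<^bsub>A\<^esub> x') y = tensor A B x y \<oplus>\<^bsub>tensor_alg A B\<^esub> tensor A B x' y"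
    if "x \<in> carrier A" "x' \<in> carrier A" "y \<in> carrier B" for x x' y
    using that *[OF bilinear_relsI(1)[OF that]]
    by (simp add: simps) (rule proj_diff_eq, simp_all add: c diff_diff_add)
  show "tensor A B x (y \<oplus>\<^bsub>B\<^esub> y') = tensor A B x y \<oplus>\<^bsub>tensor_alg A B\<^esub> tensor A B x y'"
    if "x \<in> carrier A" "y \<in> carrier B" "y' \<in> carrier B" for x y y'
    using that *[OF bilinear_relsI(2)[OF that]]
    by (simp add: simps) (rule proj_diff_eq, simp_all add: c diff_diff_add)
  show "tensor A B (s \<odot>\<^bsub>A\<^esub> x) y = s \<odot>\<^bsub>tensor_alg A B\<^esub> tensor A B x y"
    if "x \<in> carrier A" "y \<in> carrier B" for s x y
    using that *[OF bilinear_relsI(3)[OF that]]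
    by (simp add: simps) (rule proj_diff_eq, simp_all add: c)
  show "tensor A B x (s \<odot>\<^bsub>B\<^esub> y) = s \<odot>\<^bsub>tensor_alg A B\<^esub> tensor A B x y"
    if "x \<in> carrier A" "y \<in> carrier B" for s x y
    using that *[OF bilinear_relsI(4)[OF that]]
    by (simp add: simps) (rule proj_diff_eq, simp_all add: c)
qed simp

lemmas tensor_bilinear = bilinear_mapD(2-5)[OF bilinear_map_tensor]

lemma tensor_mult:
  "\<lbrakk>x \<in> carrier A; y \<in> carrier B; x' \<in> carrier A; y' \<in> carrier B\<rbrakk> \<Longrightarrow>
    tensor A B x y \<otimes>\<^bsub>tensor_alg A B\<^esub> tensor A B x' y' = tensor A B (x \<otimes>\<^bsub>A\<^esub> x') (y \<otimes>\<^bsub>B\<^esub> y')"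
  by (simp add: tensor_def tensor_alg_def Q.quot_alg_simps single_carrier monoid_alg_mult_single)

lemma tensor_one: "\<one>\<^bsub>tensor_alg A B\<^esub> = tensor A B \<one>\<^bsub>A\<^esub> \<one>\<^bsub>B\<^esub>"
  by (simp add: tensor_def tensor_alg_def Q.quot_alg_simps) (simp add: monoid_alg_simps)

text \<open>A scalar can be absorbed into the left factor, so every element is a sum of pure tensors
  and no scalar case is needed.\<close>

lemma tensor_induct [consumes 1, case_names tensor add]:
  assumes "t \<in> carrier (tensor_alg A B)"
    and pure: "\<And>x y. \<lbrakk>x \<in> carrier A; y \<in> carrier B\<rbrakk> \<Longrightarrow> P (tensor A B x y)"
    and add: "\<And>t t'. \<lbrakk>t \<in> carrier (tensor_alg A B); t' \<in> carrier (tensor_alg A B); P t; P t'\<rbrakk>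
      \<Longrightarrow> P (t \<oplus>\<^bsub>tensor_alg A B\<^esub> t')"
  shows "P t"
proof -
  note p = Q.proj_alg_hom[folded tensor_alg_def]
  obtain f where f: "f \<in> carrier (monoid_alg (A \<times>\<times> B))" "t = Q.proj f"
    using assms(1) by (auto simp: tensor_alg_def Q.quot_alg_carrier)
  have s: "Q.proj (Poly_Mapping.single (x, y) c) = tensor A B (c \<odot>\<^bsub>A\<^esub> x) y"
    if "x \<in> carrier A" "y \<in> carrier B" for x y c
    using that alg_hom_smult[OF p, of "formal x y" c] single_carrier[OF that]
    by (simp add: tensor_bilinear) (simp add: tensor_def monoid_alg_simps)
  have "P (Q.proj f)"
    using f(1) unfolding monoid_alg_simps(1) mem_Collect_eq
  proof (induction f rule: keys_subset_induct)
    case zero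
    \<comment> \<open>The empty sum has to be presented as a pure tensor too; zero tensor zero
      serves.\<close>
    have "Q.proj 0 = Q.proj (Poly_Mapping.single (\<zero>\<^bsub>A\<^esub>, \<zero>\<^bsub>B\<^esub>) 0)" by simp
    then show ?case using pure s by (metis A.zero_closed A.smult_zero B.zero_closed)
  next
    case (single_add k c f)
    then obtain x y where k: "k = (x, y)" "x \<in> carrier A" "y \<in> carrier B" by auto
    have f: "f \<in> carrier (monoid_alg (A \<times>\<times> B))" using single_add by (simp add: monoid_alg_simps)
    have "Q.proj (Poly_Mapping.single k c + f)
        = tensor A B (c \<odot>\<^bsub>A\<^esub> x) y \<oplus>\<^bsub>tensor_alg A B\<^esub> Q.proj f"
      using alg_hom_add[OF p single_carrier[OF k(2,3)] f] k s
      by (simp add: monoid_alg_simps)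
    then show ?case
      using single_add f k by (auto intro!: add pure alg_hom_closed[OF p])
  qed
  then show ?thesis using f by simp
qed

context
  fixes P :: "(complex, 'p, 'r) module_scheme" and \<beta> :: "'a \<Rightarrow> 'b \<Rightarrow> 'p"
  assumes P: "complex_algebra P" and \<beta>: "bilinear_map A B P \<beta>"
begin

lemma tensor_lift_premises:
  "lin_ext P (\<lambda>(x, y). \<beta> x y) \<in> lin_hom (monoid_alg (A \<times>\<times> B)) P"
  "f \<in> tensor_rels A B \<Longrightarrow> lin_ext P (\<lambda>(x, y). \<beta> x y) f = \<zero>\<^bsub>P\<^esub>"
proof -
  interpret P: complex_algebra P by (rule P)
  let ?h = "lin_ext P (\<lambda>(x, y). \<beta> x y)"
  note b = bilinear_mapD[OF \<beta>]
  show h: "?h \<in> lin_hom (monoid_alg (A \<times>\<times> B)) P"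
    by (rule P.lin_ext_lin_hom) (auto simp: b)
  have d: "?h (f - g) = ?h f \<oplus>\<^bsub>P\<^esub> (- 1) \<odot>\<^bsub>P\<^esub> ?h g"
    if "f \<in> carrier (monoid_alg (A \<times>\<times> B))" "g \<in> carrier (monoid_alg (A \<times>\<times> B))" for f g
    using that lin_hom_add[OF h, of f "(- 1) \<odot>\<^bsub>monoid_alg (A \<times>\<times> B)\<^esub> g"]
    by (simp add: lin_hom_smult[OF h]) (simp add: monoid_alg_simps map_mult_uminus)
  \<comment> \<open>The cancellation u + u' - u - u' = 0 in the bracketing in which the additivity
    relations produce it.\<close>
  have n: "u \<oplus>\<^bsub>P\<^esub> (u' \<oplus>\<^bsub>P\<^esub> (\<ominus>\<^bsub>P\<^esub> u \<oplus>\<^bsub>P\<^esub> \<ominus>\<^bsub>P\<^esub> u')) = \<zero>\<^bsub>P\<^esub>"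
    if "u \<in> carrier P" "u' \<in> carrier P" for u u'
    using that P.a_lcomm[of u' "\<ominus>\<^bsub>P\<^esub> u" "\<ominus>\<^bsub>P\<^esub> u'"] by (simp add: P.r_neg)
  \<comment> \<open>Vanishing on the span is phrased as membership in the zero submodule.\<close>
  have z: "submodule {\<zero>\<^bsub>P\<^esub>} complex_alg P"
    by (rule P.submoduleI) auto
  have "?h f \<in> {\<zero>\<^bsub>P\<^esub>}" if "f \<in> tensor_rels A B"
  proof (rule lin_hom_lin_span[OF M.complex_algebra_axioms P h z bilinear_rels_carrier _
        that[unfolded tensor_rels_def]])
    fix f assume "f \<in> bilinear_rels A B"
    then show "?h f \<in> {\<zero>\<^bsub>P\<^esub>}"
      by (cases rule: bilinear_rels_cases)
        (simp_all add: d diff_carrier single_carrier b, simp_all add: P.a_inv_eq_smult[symmetric]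
          P.smult_add_right P.a_ac P.r_neg n b)
  qed
  then show "f \<in> tensor_rels A B \<Longrightarrow> ?h f = \<zero>\<^bsub>P\<^esub>" by simp
qed

lemma tensor_lift_lin_hom: "tensor_lift P \<beta> \<in> lin_hom (tensor_alg A B) P"
  unfolding tensor_lift_def tensor_alg_def
  by (rule coset_ext_lin_hom[OF P Q.quotient_algebra_axioms]) (fact tensor_lift_premises)+

lemma tensor_lift_tensor:
  assumes "x \<in> carrier A" "y \<in> carrier B"
  shows "tensor_lift P \<beta> (tensor A B x y) = \<beta> x y"
proof -
  interpret P: complex_algebra P by (rule P)
  note b = bilinear_mapD[OF \<beta>]
  have "tensor_lift P \<beta> (tensor A B x y) = lin_ext P (\<lambda>(x, y). \<beta> x y) (formal x y)"
    unfolding tensor_lift_def tensor_def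
    by (rule coset_ext_proj[OF P Q.quotient_algebra_axioms])
      (use tensor_lift_premises single_carrier[OF assms] in auto)
  then show ?thesis using b assms by simp
qed

lemma tensor_lift_alg_hom:
  assumes mult: "\<And>x y x' y'. \<lbrakk>x \<in> carrier A; y \<in> carrier B; x' \<in> carrier A; y' \<in> carrier B\<rbrakk> \<Longrightarrow>
      \<beta> (x \<otimes>\<^bsub>A\<^esub> x') (y \<otimes>\<^bsub>B\<^esub> y') = \<beta> x y \<otimes>\<^bsub>P\<^esub> \<beta> x' y'"
    and one: "\<beta> \<one>\<^bsub>A\<^esub> \<one>\<^bsub>B\<^esub> = \<one>\<^bsub>P\<^esub>"
  shows "tensor_lift P \<beta> \<in> alg_hom (tensor_alg A B) P"
proof (rule alg_homI[OF tensor_lift_lin_hom])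
  interpret P: complex_algebra P by (rule P)
  note b = bilinear_mapD[OF \<beta>]
  note l = lin_homD[OF tensor_lift_lin_hom]
  show "tensor_lift P \<beta> \<one>\<^bsub>tensor_alg A B\<^esub> = \<one>\<^bsub>P\<^esub>"
    by (simp add: tensor_one tensor_lift_tensor one)
  fix t t' assume t: "t \<in> carrier (tensor_alg A B)" and t': "t' \<in> carrier (tensor_alg A B)"
  have 1: "tensor_lift P \<beta> (tensor A B x y \<otimes>\<^bsub>tensor_alg A B\<^esub> t')
      = \<beta> x y \<otimes>\<^bsub>P\<^esub> tensor_lift P \<beta> t'" if "x \<in> carrier A" "y \<in> carrier B" for x y
    using t' that
    by (induction t' rule: tensor_induct)
      (simp_all add: tensor_mult tensor_lift_tensor mult T.r_distr l P.r_distr b)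
  show "tensor_lift P \<beta> (t \<otimes>\<^bsub>tensor_alg A B\<^esub> t') = tensor_lift P \<beta> t \<otimes>\<^bsub>P\<^esub> tensor_lift P \<beta> t'"
    using t t'
    by (induction t rule: tensor_induct)
      (simp_all add: 1 tensor_lift_tensor T.l_distr l P.l_distr)
qed

end

end

lemma tensor_productI: "\<lbrakk>complex_algebra A; complex_algebra B\<rbrakk> \<Longrightarrow> tensor_product A B"
  by (simp add: tensor_product_def)

lemma tensor_map_bilinear:
  assumes "tensor_product A' B'" and f: "f \<in> lin_hom A A'" and g: "g \<in> lin_hom B B'"
  shows "bilinear_map A B (tensor_alg A' B') (\<lambda>x y. tensor A' B' (f x) (g y))"
proof -
  interpret tensor_product A' B' by fact
  show ?thesis
    by (rule bilinear_mapI) (simp_all add: lin_homD[OF f] lin_homD[OF g] tensor_bilinear)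
qed

lemma tensor_map_tensor:
  assumes "tensor_product A B" "tensor_product A' B'" "f \<in> lin_hom A A'" "g \<in> lin_hom B B'"
    and "x \<in> carrier A" "y \<in> carrier B"
  shows "tensor_map A' B' f g (tensor A B x y) = tensor A' B' (f x) (g y)"
proof -
  interpret T: tensor_product A B by fact
  interpret T': tensor_product A' B' by fact
  show ?thesis
    unfolding tensor_map_def
    by (rule T.tensor_lift_tensor[OF T'.T.complex_algebra_axioms tensor_map_bilinear]) fact+
qed

lemma tensor_map_alg_hom:
  assumes "tensor_product A B" "tensor_product A' B'"
    and f: "f \<in> alg_hom A A'" and g: "g \<in> alg_hom B B'"
  shows "tensor_map A' B' f g \<in> alg_hom (tensor_alg A B) (tensor_alg A' B')"
proof -
  interpret T: tensor_product A B by fact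
  interpret T': tensor_product A' B' by fact
  show ?thesis
    unfolding tensor_map_def
    by (rule T.tensor_lift_alg_hom[OF T'.T.complex_algebra_axioms
          tensor_map_bilinear[OF assms(2) alg_hom_lin[OF f] alg_hom_lin[OF g]]])
      (simp_all add: alg_homD[OF f] alg_homD[OF g] T'.tensor_mult T'.tensor_one)
qed

section \<open>Associativity of the tensor product\<close>

locale tensor_triple = A: complex_algebra A + B: complex_algebra B + C: complex_algebra C
  for A :: "(complex, 'a, 'l) module_scheme" and B :: "(complex, 'b, 'm) module_scheme"
    and C :: "(complex, 'c, 'n) module_scheme"
begin

sublocale AB: tensor_product A B by unfold_locales
sublocale BC: tensor_product B C by unfold_locales
sublocale AB_C: tensor_product "tensor_alg A B" C by unfold_locales
sublocale A_BC: tensor_product A "tensor_alg B C" by unfold_locales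

abbreviation inner where
  "inner \<equiv> \<lambda>t z. tensor_lift (tensor_alg A (tensor_alg B C))
    (\<lambda>x y. tensor A (tensor_alg B C) x (tensor B C y z)) t"

lemma inner_bilinear:
  "z \<in> carrier C \<Longrightarrow> bilinear_map A B (tensor_alg A (tensor_alg B C))
    (\<lambda>x y. tensor A (tensor_alg B C) x (tensor B C y z))"
  by (rule bilinear_mapI) (simp_all add: BC.tensor_bilinear A_BC.tensor_bilinear)

lemmas inner_lin = AB.tensor_lift_lin_hom[OF A_BC.T.complex_algebra_axioms inner_bilinear]
lemmas inner_tensor = AB.tensor_lift_tensor[OF A_BC.T.complex_algebra_axioms inner_bilinear]

text \<open>Here z sits inside the bilinear map being lifted, so linearity in z is not an instance
  of the linearity of a lift. It is checked on pure tensors and extended additively in t.\<close>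

lemma inner_right:
  assumes "t \<in> carrier (tensor_alg A B)"
  shows "inner t \<in> lin_hom C (tensor_alg A (tensor_alg B C))"
proof (rule lin_homI)
  note simps = inner_tensor lin_homD[OF inner_lin] BC.tensor_bilinear A_BC.tensor_bilinear
    A_BC.T.a_ac A_BC.T.smult_add_right
  show "inner t z \<in> carrier (tensor_alg A (tensor_alg B C))" if "z \<in> carrier C" for z
    using lin_hom_closed[OF inner_lin] that assms by simp
  show "inner t (z \<oplus>\<^bsub>C\<^esub> z') = inner t z \<oplus>\<^bsub>tensor_alg A (tensor_alg B C)\<^esub> inner t z'"
    if "z \<in> carrier C" "z' \<in> carrier C" for z z'
    using assms by (induction t rule: AB.tensor_induct) (simp_all add: simps that)
  show "inner t (s \<odot>\<^bsub>C\<^esub> z) = s \<odot>\<^bsub>tensor_alg A (tensor_alg B C)\<^esub> inner t z" if "z \<in> carrier C" for s z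
    using assms by (induction t rule: AB.tensor_induct) (simp_all add: simps that)
qed

lemma outer_bilinear:
  "bilinear_map (tensor_alg A B) C (tensor_alg A (tensor_alg B C)) inner"
  by (simp add: bilinear_map_def inner_lin inner_right)

text \<open>Multiplicativity of the reassociation map makes both sides of coassociativity algebra
  homomorphisms, which permits checking it on generators.\<close>

lemma tensor_assoc_alg_hom:
  "tensor_assoc A B C
    \<in> alg_hom (tensor_alg (tensor_alg A B) C) (tensor_alg A (tensor_alg B C))"
  unfolding tensor_assoc_def
proof (rule AB_C.tensor_lift_alg_hom[OF A_BC.T.complex_algebra_axioms outer_bilinear])
  note lin = lin_homD[OF inner_lin]
  show "inner \<one>\<^bsub>tensor_alg A B\<^esub> \<one>\<^bsub>C\<^esub> = \<one>\<^bsub>tensor_alg A (tensor_alg B C)\<^esub>"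
    by (simp add: AB.tensor_one BC.tensor_one A_BC.tensor_one inner_tensor)
  fix t t' z z' assume t: "t \<in> carrier (tensor_alg A B)" "t' \<in> carrier (tensor_alg A B)"
    and z: "z \<in> carrier C" "z' \<in> carrier C"
  have 1: "inner (tensor A B x y \<otimes>\<^bsub>tensor_alg A B\<^esub> t') (z \<otimes>\<^bsub>C\<^esub> z')
      = inner (tensor A B x y) z \<otimes>\<^bsub>tensor_alg A (tensor_alg B C)\<^esub> inner t' z'"
    if xy: "x \<in> carrier A" "y \<in> carrier B" for x y
    using t(2)
    by (induction t' rule: AB.tensor_induct)
      (simp_all add: xy z AB.tensor_mult BC.tensor_mult A_BC.tensor_mult inner_tensor
        AB.T.r_distr A_BC.T.r_distr lin)
  show "inner (t \<otimes>\<^bsub>tensor_alg A B\<^esub> t') (z \<otimes>\<^bsub>C\<^esub> z')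
      = inner t z \<otimes>\<^bsub>tensor_alg A (tensor_alg B C)\<^esub> inner t' z'"
    using t(1)
    by (induction t rule: AB.tensor_induct)
      (simp_all add: 1 t z AB.T.l_distr A_BC.T.l_distr lin)
qed

lemma tensor_assoc_tensor:
  "\<lbrakk>x \<in> carrier A; y \<in> carrier B; z \<in> carrier C\<rbrakk> \<Longrightarrow>
    tensor_assoc A B C (tensor (tensor_alg A B) C (tensor A B x y) z)
      = tensor A (tensor_alg B C) x (tensor B C y z)"
  unfolding tensor_assoc_def
  by (simp add: AB_C.tensor_lift_tensor[OF A_BC.T.complex_algebra_axioms outer_bilinear] inner_tensor)

end

section \<open>The quantum group\<close>

lemma functional_simps:
  assumes "\<phi> \<in> lin_hom A complex_alg"
  shows "\<lbrakk>x \<in> carrier A; y \<in> carrier A\<rbrakk> \<Longrightarrow> \<phi> (x \<oplus>\<^bsub>A\<^esub> y) = \<phi> x + \<phi> y"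
    and "x \<in> carrier A \<Longrightarrow> \<phi> (s \<odot>\<^bsub>A\<^esub> x) = s * \<phi> x"
  using lin_homD[OF assms] by simp_all

lemma functional_zero:
  assumes "complex_algebra A" "\<phi> \<in> lin_hom A complex_alg"
  shows "\<phi> \<zero>\<^bsub>A\<^esub> = 0"
  using lin_hom_zero[OF assms(1) complex_algebra_complex_alg assms(2)] by simp

section \<open>Rewriting words in the matrix entries\<close>

context complex_algebra
begin

text \<open>Words are kept nested to the right, where x y is no subterm of x (y z). Each commutation
  rule therefore needs this second form, acting on the first two letters of a longer word.\<close>

lemma assoc_subst:
  "\<lbrakk>x \<otimes> y = w; x \<in> carrier A; y \<in> carrier A; z \<in> carrier A\<rbrakk> \<Longrightarrow> x \<otimes> (y \<otimes> z) = w \<otimes> z"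
  by (auto simp: m_assoc)

lemmas expand = m_assoc l_distr r_distr smult_mult_left smult_mult_right smult_smult
  smult_add_right

text \<open>Multiply D x = s x D by the inverse of D on both sides.\<close>

lemma inverse_commute:
  assumes "x \<in> carrier A" "D \<in> carrier A" "i \<in> carrier A" "D \<otimes> i = \<one>" "i \<otimes> D = \<one>"
    and "D \<otimes> x = s \<odot> (x \<otimes> D)" "s \<noteq> 0"
  shows "i \<otimes> x = inverse s \<odot> (x \<otimes> i)"
proof -
  have "x \<otimes> i = (i \<otimes> (D \<otimes> x)) \<otimes> i"
    using assms(1-5) by (simp add: m_assoc[symmetric])
  also have "\<dots> = s \<odot> (i \<otimes> (x \<otimes> (D \<otimes> i)))"
    unfolding assms(6) using assms(1-3) by (simp add: expand)
  finally show ?thesis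
    using assms by (simp add: smult_smult)
qed

end

text \<open>A point of the quantum group with values in A. The defining relations are solved for the
  products in the wrong order, giving rewrite rules towards a < b < c < d. In the rule for
  \<open>da\<close> the coefficient q - 1/p arises by replacing cb with (q/p) bc in ad - cb/q = da -
  q bc; the same replacement gives the determinant its form ad - bc/p.\<close>

locale GL_tuple = complex_algebra A for A :: "(complex, 'a, 'm) module_scheme" (structure) +
  fixes p q :: complex and a b c d i
  assumes pq: "p \<noteq> 0" "q \<noteq> 0"
    and closed [simp]: "a \<in> carrier A" "b \<in> carrier A" "c \<in> carrier A" "d \<in> carrier A" "i \<in> carrier A"
    and ba: "b \<otimes> a = p \<odot> (a \<otimes> b)"
    and dc: "d \<otimes> c = p \<odot> (c \<otimes> d)"
    and ca: "c \<otimes> a = q \<odot> (a \<otimes> c)"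
    and db: "d \<otimes> b = q \<odot> (b \<otimes> d)"
    and cb: "c \<otimes> b = (q / p) \<odot> (b \<otimes> c)"
    and da: "d \<otimes> a = a \<otimes> d \<oplus> (q - 1 / p) \<odot> (b \<otimes> c)"
    and det_inv: "(a \<otimes> d \<oplus> (- (1 / p)) \<odot> (b \<otimes> c)) \<otimes> i = \<one>"
    and inv_det: "i \<otimes> (a \<otimes> d \<oplus> (- (1 / p)) \<odot> (b \<otimes> c)) = \<one>"
begin

definition det where "det = a \<otimes> d \<oplus> (- (1 / p)) \<odot> (b \<otimes> c)"

lemma det_closed [simp]: "det \<in> carrier A"
  by (simp add: det_def)

lemma det_inv' [simp]: "det \<otimes> i = \<one>" "i \<otimes> det = \<one>"
  by (simp_all only: det_def det_inv inv_det)

lemmas entries_comm = ba dc ca db cb da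
  ba[THEN assoc_subst, OF closed(2,1)] dc[THEN assoc_subst, OF closed(4,3)]
  ca[THEN assoc_subst, OF closed(3,1)] db[THEN assoc_subst, OF closed(4,2)]
  cb[THEN assoc_subst, OF closed(3,2)] da[THEN assoc_subst, OF closed(4,1)]

text \<open>The determinant commutes with each entry up to a scalar. The scalar 1 is written out for
  a and d so that all four equations have the shape that \<open>inverse_commute\<close>
  expects.\<close>

lemma det_comm:
  "det \<otimes> a = 1 \<odot> (a \<otimes> det)" "det \<otimes> b = (q / p) \<odot> (b \<otimes> det)"
  "det \<otimes> c = (p / q) \<odot> (c \<otimes> det)" "det \<otimes> d = 1 \<odot> (d \<otimes> det)"
  using pq by (rule_tac [!] eq_functionalI)
    (auto simp: det_def expand entries_comm functional_simps field_simps)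

lemma inv_comm:
  "i \<otimes> a = a \<otimes> i" "i \<otimes> b = (p / q) \<odot> (b \<otimes> i)" "i \<otimes> c = (q / p) \<odot> (c \<otimes> i)" "i \<otimes> d = d \<otimes> i"
  using det_comm[THEN inverse_commute[rotated 5]] pq by simp_all

lemmas inv_comm' = inv_comm(1)[THEN assoc_subst, OF closed(5,1)]
  inv_comm(2)[THEN assoc_subst, OF closed(5,2)] inv_comm(3)[THEN assoc_subst, OF closed(5,3)]
  inv_comm(4)[THEN assoc_subst, OF closed(5,4)]

lemmas normalize = expand entries_comm inv_comm inv_comm'

text \<open>The inverse relation read as a rewrite rule: it eliminates the word a d i, the one place
  where a sorted word can still be shortened by cancelling the determinant.\<close>

lemma adi: "a \<otimes> (d \<otimes> i) = \<one> \<oplus> (1 / p) \<odot> (b \<otimes> (c \<otimes> i))"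
proof (rule eq_functionalI)
  fix \<phi> assume \<phi>: "\<phi> \<in> lin_hom A complex_alg"
  show "\<phi> (a \<otimes> (d \<otimes> i)) = \<phi> (\<one> \<oplus> (1 / p) \<odot> (b \<otimes> (c \<otimes> i)))"
    using arg_cong[OF det_inv, of \<phi>] by (simp add: expand functional_simps[OF \<phi>] diff_eq_eq)
qed simp_all

text \<open>This tuple is the inverse matrix. The factors -p and -1/p are those for which the
  off-diagonal entries of the product with the original matrix cancel, by ba = p ab and dc = p cd.
  Inversion reverses products, so the same relations hold in the opposite algebra, and the new
  determinant is i, whose inverse is \<open>det\<close>.\<close>

lemma GL_tuple_opposite:
  "GL_tuple (A\<lparr>mult := \<lambda>x y. y \<otimes> x\<rparr>) p q (d \<otimes> i) ((- p) \<odot> (b \<otimes> i)) ((- (1 / p)) \<odot> (c \<otimes> i)) (a \<otimes> i) det"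
proof -
  interpret Op: complex_algebra "A\<lparr>mult := \<lambda>x y. y \<otimes> x\<rparr>"
    by (rule complex_algebra_opposite) (rule complex_algebra_axioms)
  let ?a = "d \<otimes> i" and ?b = "(- p) \<odot> (b \<otimes> i)" and ?c = "(- (1 / p)) \<odot> (c \<otimes> i)" and ?d = "a \<otimes> i"
  \<comment> \<open>Both right-hand sides equal i, but in this form sorting alone proves the
    equations, without cancelling a determinant. One ordering telescopes when multiplied by
    \<open>det\<close> from the left, the other from the right.\<close>
  have det': "?d \<otimes> ?a \<oplus> (- (1 / p)) \<odot> (?c \<otimes> ?b) = det \<otimes> (i \<otimes> i)"
    "?d \<otimes> ?a \<oplus> (- (1 / p)) \<odot> (?c \<otimes> ?b) = i \<otimes> (i \<otimes> det)"
    using pq by (rule_tac [!] eq_functionalI)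
      (auto simp: det_def normalize functional_simps field_simps)
  have 1: "i \<otimes> (i \<otimes> det) \<otimes> det = \<one>" "det \<otimes> (det \<otimes> (i \<otimes> i)) = \<one>"
    by (simp_all add: m_assoc assoc_subst[OF det_inv'(1)])
  show ?thesis
  proof (unfold_locales, goal_cases)
    \<comment> \<open>Goals 14 and 15 are the two inverse laws for the determinant; products are
      reversed in the opposite algebra, so 14 needs \<open>det\<close> on the left.\<close>
    case 14
    then show ?case using 1(2) unfolding det'(1)[symmetric] by simp
  next
    case 15
    then show ?case using 1(1) unfolding det'(2)[symmetric] by simp
  qed (simp_all add: pq, (rule eq_functionalI; insert pq; simp add: normalize functional_simps field_simps)+)
qed

text \<open>These are the entries of S(M) M = 1, then those of M S(M) = 1, for the matrix M of
  generators and its inverse S(M).\<close>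

lemma antipode_rules:
  "d \<otimes> i \<otimes> a \<oplus> ((- p) \<odot> (b \<otimes> i)) \<otimes> c = \<one>"
  "d \<otimes> i \<otimes> b \<oplus> ((- p) \<odot> (b \<otimes> i)) \<otimes> d = \<zero>"
  "((- (1 / p)) \<odot> (c \<otimes> i)) \<otimes> a \<oplus> a \<otimes> i \<otimes> c = \<zero>"
  "((- (1 / p)) \<odot> (c \<otimes> i)) \<otimes> b \<oplus> a \<otimes> i \<otimes> d = \<one>"
  "a \<otimes> (d \<otimes> i) \<oplus> b \<otimes> ((- (1 / p)) \<odot> (c \<otimes> i)) = \<one>"
  "a \<otimes> ((- p) \<odot> (b \<otimes> i)) \<oplus> b \<otimes> (a \<otimes> i) = \<zero>"
  "c \<otimes> (d \<otimes> i) \<oplus> d \<otimes> ((- (1 / p)) \<odot> (c \<otimes> i)) = \<zero>"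
  "c \<otimes> ((- p) \<odot> (b \<otimes> i)) \<oplus> d \<otimes> (a \<otimes> i) = \<one>"
  using pq by (rule_tac [!] eq_functionalI)
    (auto simp: normalize adi functional_simps functional_zero[OF complex_algebra_axioms] field_simps)

end

text \<open>The bridge between the presentation and the rewrite rules. Together with the lifting
  lemmas for presented algebras it identifies homomorphisms out of O(GL_{p,q}(2)) with
  tuples.\<close>

lemma GL_rels_iff:
  fixes A :: "(complex, 'a, 'm) module_scheme" (structure)
  assumes A: "complex_algebra A" and v: "\<forall>g. v g \<in> carrier A" and pq: "p \<noteq> 0" "q \<noteq> 0"
  shows "(\<forall>x\<in>GL_rels p q. lin_ext A (word_prod A v) x = \<zero>\<^bsub>A\<^esub>)
    \<longleftrightarrow> GL_tuple A p q (v Ga) (v Gb) (v Gc) (v Gd) (v Gi)" (is "?L \<longleftrightarrow> ?R")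
proof -
  interpret complex_algebra A by fact
  have [simp]: "v g \<in> carrier A" for g using v by simp
  note ev = word_eval_diff[OF v] word_eval_single[OF v]
  note f = functional_simps functional_zero[OF A]
  show ?thesis
  proof
    assume L: ?L
    \<comment> \<open>The original relations under an arbitrary functional. Solving them for the
      unsorted product uses that p and q are nonzero.\<close>
    have E: "\<phi> (v Ga \<otimes> v Gb) = inverse p * \<phi> (v Gb \<otimes> v Ga)"
      "\<phi> (v Gc \<otimes> v Gd) = inverse p * \<phi> (v Gd \<otimes> v Gc)"
      "\<phi> (v Ga \<otimes> v Gc) = inverse q * \<phi> (v Gc \<otimes> v Ga)"
      "\<phi> (v Gb \<otimes> v Gd) = inverse q * \<phi> (v Gd \<otimes> v Gb)"
      "q * \<phi> (v Gb \<otimes> v Gc) = p * \<phi> (v Gc \<otimes> v Gb)"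
      "\<phi> (v Ga \<otimes> v Gd) - inverse q * \<phi> (v Gc \<otimes> v Gb)
        + (q * \<phi> (v Gb \<otimes> v Gc) - \<phi> (v Gd \<otimes> v Ga)) = 0"
      "\<phi> (v Ga \<otimes> (v Gd \<otimes> v Gi)) - inverse q * \<phi> (v Gc \<otimes> (v Gb \<otimes> v Gi)) = \<phi> \<one>"
      "\<phi> (v Gi \<otimes> (v Ga \<otimes> v Gd)) - inverse q * \<phi> (v Gi \<otimes> (v Gc \<otimes> v Gb)) = \<phi> \<one>"
      if \<phi>: "\<phi> \<in> lin_hom A complex_alg" for \<phi>
    proof -
      have "\<forall>x\<in>GL_rels p q. \<phi> (lin_ext A (word_prod A v) x) = 0"
        using L functional_zero[OF A \<phi>] by simp
      then show "\<phi> (v Ga \<otimes> v Gb) = inverse p * \<phi> (v Gb \<otimes> v Ga)"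
        "\<phi> (v Gc \<otimes> v Gd) = inverse p * \<phi> (v Gd \<otimes> v Gc)"
        "\<phi> (v Ga \<otimes> v Gc) = inverse q * \<phi> (v Gc \<otimes> v Ga)"
        "\<phi> (v Gb \<otimes> v Gd) = inverse q * \<phi> (v Gd \<otimes> v Gb)"
        "q * \<phi> (v Gb \<otimes> v Gc) = p * \<phi> (v Gc \<otimes> v Gb)"
        "\<phi> (v Ga \<otimes> v Gd) - inverse q * \<phi> (v Gc \<otimes> v Gb)
          + (q * \<phi> (v Gb \<otimes> v Gc) - \<phi> (v Gd \<otimes> v Ga)) = 0"
        "\<phi> (v Ga \<otimes> (v Gd \<otimes> v Gi)) - inverse q * \<phi> (v Gc \<otimes> (v Gb \<otimes> v Gi)) = \<phi> \<one>"
        "\<phi> (v Gi \<otimes> (v Ga \<otimes> v Gd)) - inverse q * \<phi> (v Gi \<otimes> (v Gc \<otimes> v Gb)) = \<phi> \<one>"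
        by (auto simp: GL_rels_def Let_def ev functional_simps[OF \<phi>])
    qed
    \<comment> \<open>This rule comes first because the presentation writes the determinant with cb,
      while the tuple writes it with bc; the goals 13, 14 and 15 all need the conversion.\<close>
    have cb: "v Gc \<otimes> v Gb = (q / p) \<odot> (v Gb \<otimes> v Gc)"
      by (rule eq_functionalI) (use pq E(5) in \<open>auto simp: functional_simps field_simps\<close>)
    show ?R
    proof (unfold_locales, goal_cases)
      case 14
      show ?case
        by (rule eq_functionalI) (use pq E(7) in \<open>auto simp: expand cb
          assoc_subst[OF cb] functional_simps field_simps\<close>)
    next
      case 15
      show ?case
        by (rule eq_functionalI) (use pq E(8) in \<open>auto simp: expand cb
          assoc_subst[OF cb] functional_simps field_simps\<close>)
    next
      case 13
      show ?case
        by (rule eq_functionalI) (use pq E(6) in \<open>auto simp: expand cb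
          functional_simps field_simps\<close>)
    qed (simp_all add: pq cb, (rule eq_functionalI; insert pq; simp add: E functional_simps field_simps)+)
  next
    assume ?R
    then interpret GL_tuple A p q "v Ga" "v Gb" "v Gc" "v Gd" "v Gi" .
    show ?L
      unfolding GL_rels_def Let_def using pq
      by (auto simp: ev intro!: eq_functionalI)
        (simp_all add: normalize adi f field_simps)
  qed
qed

locale GL_tuple_pair = A: GL_tuple A p q a b c d i + B: GL_tuple B p q a' b' c' d' i'
  for A :: "(complex, 'a, 'm) module_scheme" and p q a b c d i
    and B :: "(complex, 'b, 'n) module_scheme" and a' b' c' d' i'
begin

sublocale tensor_product A B by unfold_locales

abbreviation t where "t \<equiv> tensor A B"

text \<open>Multiplicativity of the quantum determinant. Entries of the two matrices lie in
  different tensor factors and so commute with one another; each factor is sorted by its own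
  rules.\<close>

lemma tensor_det:
  "(t a a' \<oplus>\<^bsub>tensor_alg A B\<^esub> t b c') \<otimes>\<^bsub>tensor_alg A B\<^esub> (t c b' \<oplus>\<^bsub>tensor_alg A B\<^esub> t d d')
    \<oplus>\<^bsub>tensor_alg A B\<^esub> (- (1 / p)) \<odot>\<^bsub>tensor_alg A B\<^esub>
     ((t a b' \<oplus>\<^bsub>tensor_alg A B\<^esub> t b d') \<otimes>\<^bsub>tensor_alg A B\<^esub> (t c a' \<oplus>\<^bsub>tensor_alg A B\<^esub> t d c'))
    = t A.det B.det"
  using A.pq
  by (intro T.eq_functionalI)
    (auto simp: A.det_def B.det_def A.normalize B.normalize T.expand tensor_mult tensor_bilinear
      functional_simps field_simps)

text \<open>The matrix product of two mutually commuting points is again a point. Its determinant is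
  the pure tensor of the two determinants, which is why \<open>t i i'\<close> inverts it.\<close>

lemma GL_tuple_tensor:
  "GL_tuple (tensor_alg A B) p q
    (t a a' \<oplus>\<^bsub>tensor_alg A B\<^esub> t b c') (t a b' \<oplus>\<^bsub>tensor_alg A B\<^esub> t b d')
    (t c a' \<oplus>\<^bsub>tensor_alg A B\<^esub> t d c') (t c b' \<oplus>\<^bsub>tensor_alg A B\<^esub> t d d') (t i i')"
proof (unfold_locales, goal_cases)
  case 14
  then show ?case unfolding tensor_det by (simp add: tensor_mult tensor_one)
next
  case 15
  then show ?case unfolding tensor_det by (simp add: tensor_mult tensor_one)
qed (simp_all add: A.pq, (rule T.eq_functionalI; insert A.pq;
    simp add: A.normalize B.normalize T.expand tensor_mult tensor_bilinear functional_simps field_simps)+)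

end

section \<open>Convolution with the antipode, and contraction with the counit\<close>

lemma alg_hom_opposite_iff:
  "S \<in> alg_hom H (H\<lparr>mult := \<lambda>x y. y \<otimes>\<^bsub>H\<^esub> x\<rparr>) \<longleftrightarrow>
    S \<in> lin_hom H H \<and> (\<forall>x\<in>carrier H. \<forall>y\<in>carrier H. S (x \<otimes>\<^bsub>H\<^esub> y) = S y \<otimes>\<^bsub>H\<^esub> S x) \<and>
    S \<one>\<^bsub>H\<^esub> = \<one>\<^bsub>H\<^esub>"
  by (auto simp: alg_hom_def lin_hom_def ring_hom_def)

text \<open>The convolutions \<open>S * id\<close> and \<open>id * S\<close> are not multiplicative, but if the first factor of a
  product is sent to a scalar (for \<open>S * id\<close>; the second one for \<open>id * S\<close>), that scalar is central
  and can be pulled out, so the antipode identities pass to products.\<close>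

lemma convolution_mult:
  fixes H :: "(complex, 'h, 'm) module_scheme" (structure)
  assumes H: "complex_algebra H" and lin: "S \<in> lin_hom H H"
    and anti: "\<And>x y. \<lbrakk>x \<in> carrier H; y \<in> carrier H\<rbrakk> \<Longrightarrow> S (x \<otimes> y) = S y \<otimes> S x"
    and t: "t \<in> carrier (tensor_alg H H)" and t': "t' \<in> carrier (tensor_alg H H)"
  shows "tensor_lift H (\<lambda>y z. S y \<otimes> z) t = s \<odot> \<one> \<Longrightarrow>
      tensor_lift H (\<lambda>y z. S y \<otimes> z) (t \<otimes>\<^bsub>tensor_alg H H\<^esub> t')
        = s \<odot> tensor_lift H (\<lambda>y z. S y \<otimes> z) t'"
    and "tensor_lift H (\<lambda>y z. y \<otimes> S z) t' = s \<odot> \<one> \<Longrightarrow>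
      tensor_lift H (\<lambda>y z. y \<otimes> S z) (t \<otimes>\<^bsub>tensor_alg H H\<^esub> t')
        = s \<odot> tensor_lift H (\<lambda>y z. y \<otimes> S z) t"
proof -
  interpret complex_algebra H by fact
  interpret HH: tensor_product H H by (rule tensor_productI) fact+
  note S = lin_homD[OF lin]
  have bl: "bilinear_map H H H (\<lambda>y z. S y \<otimes> z)" "bilinear_map H H H (\<lambda>y z. y \<otimes> S z)"
    by (rule_tac [!] bilinear_mapI) (simp_all add: S l_distr r_distr smult_mult_left smult_mult_right)
  let ?L = "tensor_lift H (\<lambda>y z. S y \<otimes> z)" and ?R = "tensor_lift H (\<lambda>y z. y \<otimes> S z)"
  note L = lin_homD[OF HH.tensor_lift_lin_hom[OF H bl(1)]] HH.tensor_lift_tensor[OF H bl(1)]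
  note R = lin_homD[OF HH.tensor_lift_lin_hom[OF H bl(2)]] HH.tensor_lift_tensor[OF H bl(2)]
  show "?L (t \<otimes>\<^bsub>tensor_alg H H\<^esub> t') = s \<odot> ?L t'" if "?L t = s \<odot> \<one>"
  proof -
    \<comment> \<open>As S reverses products, the contributions of u and v end up outside, with
      \<open>?L t\<close> between them. Once \<open>?L t\<close> is a scalar it can be moved to the
      front.\<close>
    have 1: "?L (t \<otimes>\<^bsub>tensor_alg H H\<^esub> tensor H H u v) = S u \<otimes> (?L t \<otimes> v)"
      if "u \<in> carrier H" "v \<in> carrier H" for u v
      using t by (induction t rule: HH.tensor_induct)
        (simp_all add: that S L anti m_assoc l_distr r_distr HH.tensor_mult HH.T.l_distr)
    show ?thesis
      using t' by (induction t' rule: HH.tensor_induct)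
        (simp_all add: 1 that t L S HH.T.r_distr smult_mult_left smult_mult_right smult_add_right)
  qed
  show "?R (t \<otimes>\<^bsub>tensor_alg H H\<^esub> t') = s \<odot> ?R t" if "?R t' = s \<odot> \<one>"
  proof -
    have 1: "?R (tensor H H u v \<otimes>\<^bsub>tensor_alg H H\<^esub> t') = u \<otimes> (?R t' \<otimes> S v)"
      if "u \<in> carrier H" "v \<in> carrier H" for u v
      using t' by (induction t' rule: HH.tensor_induct)
        (simp_all add: that S R anti m_assoc l_distr r_distr HH.tensor_mult HH.T.r_distr)
    show ?thesis
      using t by (induction t rule: HH.tensor_induct)
        (simp_all add: 1 that t' R S HH.T.l_distr smult_mult_left smult_mult_right smult_add_right)
  qed
qed

text \<open>The counit is a character and scalars are central, so contracting one tensor factor with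
  it is multiplicative. The second algebra is arbitrary in order to serve both the counit axioms of
  the Hopf algebra and that of the coaction.\<close>

lemma counit_lift:
  assumes H: "complex_algebra H" and A: "complex_algebra A" and \<epsilon>: "\<epsilon> \<in> alg_hom H complex_alg"
  shows counit_lift_left: "tensor_lift A (\<lambda>h y. \<epsilon> h \<odot>\<^bsub>A\<^esub> y) \<in> alg_hom (tensor_alg H A) A"
    and counit_lift_left_tensor: "\<lbrakk>h \<in> carrier H; y \<in> carrier A\<rbrakk> \<Longrightarrow>
      tensor_lift A (\<lambda>h y. \<epsilon> h \<odot>\<^bsub>A\<^esub> y) (tensor H A h y) = \<epsilon> h \<odot>\<^bsub>A\<^esub> y"
    and counit_lift_right: "tensor_lift A (\<lambda>y h. \<epsilon> h \<odot>\<^bsub>A\<^esub> y) \<in> alg_hom (tensor_alg A H) A"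
    and counit_lift_right_tensor: "\<lbrakk>h \<in> carrier H; y \<in> carrier A\<rbrakk> \<Longrightarrow>
      tensor_lift A (\<lambda>y h. \<epsilon> h \<odot>\<^bsub>A\<^esub> y) (tensor A H y h) = \<epsilon> h \<odot>\<^bsub>A\<^esub> y"
proof -
  interpret H: complex_algebra H by fact
  interpret A: complex_algebra A by fact
  interpret HA: tensor_product H A by unfold_locales
  interpret AH: tensor_product A H by unfold_locales
  note simps = alg_homD[OF \<epsilon>] A.smult_smult A.smult_add_left A.smult_add_right A.smult_mult_left
    A.smult_mult_right mult.commute
  have l: "bilinear_map H A A (\<lambda>h y. \<epsilon> h \<odot>\<^bsub>A\<^esub> y)" and r: "bilinear_map A H A (\<lambda>y h. \<epsilon> h \<odot>\<^bsub>A\<^esub> y)"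
    by (rule_tac [!] bilinear_mapI) (simp_all add: simps)
  show "tensor_lift A (\<lambda>h y. \<epsilon> h \<odot>\<^bsub>A\<^esub> y) \<in> alg_hom (tensor_alg H A) A"
    by (rule HA.tensor_lift_alg_hom[OF A l]) (simp_all add: simps)
  show "tensor_lift A (\<lambda>y h. \<epsilon> h \<odot>\<^bsub>A\<^esub> y) \<in> alg_hom (tensor_alg A H) A"
    by (rule AH.tensor_lift_alg_hom[OF A r]) (simp_all add: simps)
  show "\<lbrakk>h \<in> carrier H; y \<in> carrier A\<rbrakk> \<Longrightarrow>
      tensor_lift A (\<lambda>h y. \<epsilon> h \<odot>\<^bsub>A\<^esub> y) (tensor H A h y) = \<epsilon> h \<odot>\<^bsub>A\<^esub> y"
    by (rule HA.tensor_lift_tensor[OF A l])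
  show "\<lbrakk>h \<in> carrier H; y \<in> carrier A\<rbrakk> \<Longrightarrow>
      tensor_lift A (\<lambda>y h. \<epsilon> h \<odot>\<^bsub>A\<^esub> y) (tensor A H y h) = \<epsilon> h \<odot>\<^bsub>A\<^esub> y"
    by (rule AH.tensor_lift_tensor[OF A r])
qed

section \<open>The Hopf algebra structure\<close>

locale GL_params =
  fixes p q :: complex
  assumes pq: "p \<noteq> 0" "q \<noteq> 0"
begin

abbreviation H where "H \<equiv> GL_alg p q"
abbreviation HH where "HH \<equiv> tensor_alg H H"
abbreviation g where "g \<equiv> GL_gen p q"

lemma g_closed [simp]: "g x \<in> carrier H"
  by (simp add: GL_gen_def GL_alg_def)

sublocale H: complex_algebra H
  unfolding GL_alg_def by (rule complex_algebra_pres_alg)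

text \<open>The universal point: the generators form a tuple in the algebra they present.\<close>

sublocale g: GL_tuple H p q "g Ga" "g Gb" "g Gc" "g Gd" "g Gi"
  unfolding GL_rels_iff[OF H.complex_algebra_axioms, of g, OF _ pq, simplified, symmetric]
  unfolding GL_alg_def GL_gen_def by (simp add: pres_rel)

sublocale gg: GL_tuple_pair H p q "g Ga" "g Gb" "g Gc" "g Gd" "g Gi" H "g Ga" "g Gb" "g Gc" "g Gd" "g Gi"
  by unfold_locales

sublocale HHH: tensor_triple H H H
  by unfold_locales

lemma GL_lift:
  assumes "complex_algebra B" "\<forall>x. v x \<in> carrier B"
    and "GL_tuple B p q (v Ga) (v Gb) (v Gc) (v Gd) (v Gi)"
  shows "pres_lift B v \<in> alg_hom H B" "pres_lift B v (g x) = v x"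
  using pres_lift_alg_hom[OF assms(1,2)] pres_lift_gen[OF assms(1,2)]
    GL_rels_iff[OF assms(1,2) pq] assms(3)
  unfolding GL_alg_def GL_gen_def by auto

lemma GL_induct [consumes 1, case_names one gen add mult smult]:
  assumes "x \<in> carrier H" "P \<one>\<^bsub>H\<^esub>" "\<And>x. P (g x)"
    and "\<And>x y. \<lbrakk>x \<in> carrier H; y \<in> carrier H; P x; P y\<rbrakk> \<Longrightarrow> P (x \<oplus>\<^bsub>H\<^esub> y)"
    and "\<And>x y. \<lbrakk>x \<in> carrier H; y \<in> carrier H; P x; P y\<rbrakk> \<Longrightarrow> P (x \<otimes>\<^bsub>H\<^esub> y)"
    and "\<And>s x. \<lbrakk>x \<in> carrier H; P x\<rbrakk> \<Longrightarrow> P (s \<odot>\<^bsub>H\<^esub> x)"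
  shows "P x"
  using assms unfolding GL_alg_def GL_gen_def by (rule pres_induct)

lemma GL_hom_eqI:
  assumes "f \<in> alg_hom H B" "h \<in> alg_hom H B"
    and "\<And>x. f (g x) = h (g x)" "x \<in> carrier H"
  shows "f x = h x"
  using assms unfolding GL_alg_def GL_gen_def by (rule pres_hom_eqI)

text \<open>The comultiplication is the homomorphism belonging to the product of two copies of the
  universal point, one in each tensor factor.\<close>

lemma comult:
  shows comult_hom: "GL_comult p q \<in> alg_hom H HH"
    and comult_gen: "GL_comult p q (g Ga) = tensor H H (g Ga) (g Ga) \<oplus>\<^bsub>HH\<^esub> tensor H H (g Gb) (g Gc)"
      "GL_comult p q (g Gb) = tensor H H (g Ga) (g Gb) \<oplus>\<^bsub>HH\<^esub> tensor H H (g Gb) (g Gd)"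
      "GL_comult p q (g Gc) = tensor H H (g Gc) (g Ga) \<oplus>\<^bsub>HH\<^esub> tensor H H (g Gd) (g Gc)"
      "GL_comult p q (g Gd) = tensor H H (g Gc) (g Gb) \<oplus>\<^bsub>HH\<^esub> tensor H H (g Gd) (g Gd)"
      "GL_comult p q (g Gi) = tensor H H (g Gi) (g Gi)"
proof -
  define v where "v = (\<lambda>x. case x of
           Ga \<Rightarrow> tensor H H (g Ga) (g Ga) \<oplus>\<^bsub>HH\<^esub> tensor H H (g Gb) (g Gc)
         | Gb \<Rightarrow> tensor H H (g Ga) (g Gb) \<oplus>\<^bsub>HH\<^esub> tensor H H (g Gb) (g Gd)
         | Gc \<Rightarrow> tensor H H (g Gc) (g Ga) \<oplus>\<^bsub>HH\<^esub> tensor H H (g Gd) (g Gc)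
         | Gd \<Rightarrow> tensor H H (g Gc) (g Gb) \<oplus>\<^bsub>HH\<^esub> tensor H H (g Gd) (g Gd)
         | Gi \<Rightarrow> tensor H H (g Gi) (g Gi))"
  have eq: "GL_comult p q = pres_lift HH v"
    by (simp add: GL_comult_def v_def Let_def)
  have "\<forall>x. v x \<in> carrier HH"
    by (simp add: v_def split: gl_gen.split)
  moreover have "GL_tuple HH p q (v Ga) (v Gb) (v Gc) (v Gd) (v Gi)"
    using gg.GL_tuple_tensor by (simp add: v_def)
  ultimately have *: "pres_lift HH v \<in> alg_hom H HH" "\<And>x. pres_lift HH v (g x) = v x"
    using GL_lift[OF gg.T.complex_algebra_axioms, of v] by auto
  show "GL_comult p q \<in> alg_hom H HH" using * by (simp add: eq)
  show "GL_comult p q (g Ga) = tensor H H (g Ga) (g Ga) \<oplus>\<^bsub>HH\<^esub> tensor H H (g Gb) (g Gc)"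
      "GL_comult p q (g Gb) = tensor H H (g Ga) (g Gb) \<oplus>\<^bsub>HH\<^esub> tensor H H (g Gb) (g Gd)"
      "GL_comult p q (g Gc) = tensor H H (g Gc) (g Ga) \<oplus>\<^bsub>HH\<^esub> tensor H H (g Gd) (g Gc)"
      "GL_comult p q (g Gd) = tensor H H (g Gc) (g Gb) \<oplus>\<^bsub>HH\<^esub> tensor H H (g Gd) (g Gd)"
      "GL_comult p q (g Gi) = tensor H H (g Gi) (g Gi)"
    using * by (simp_all add: eq v_def)
qed

text \<open>The counit belongs to the identity matrix, a point with complex values.\<close>

lemma counit:
  shows counit_hom: "GL_counit \<in> alg_hom H complex_alg"
    and counit_gen: "GL_counit (g Ga) = 1" "GL_counit (g Gb) = 0" "GL_counit (g Gc) = 0"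
      "GL_counit (g Gd) = 1" "GL_counit (g Gi) = 1"
proof -
  interpret C: complex_algebra complex_alg by (rule complex_algebra_complex_alg)
  have "GL_tuple complex_alg p q 1 0 0 1 1"
    using pq by unfold_locales simp_all
  then have *: "GL_counit \<in> alg_hom H complex_alg"
    "GL_counit (g x) = (case x of Ga \<Rightarrow> 1 | Gb \<Rightarrow> 0 | Gc \<Rightarrow> 0 | Gd \<Rightarrow> 1 | Gi \<Rightarrow> 1)" for x
    using GL_lift[OF complex_algebra_complex_alg, of
        "\<lambda>x. case x of Ga \<Rightarrow> 1 | Gb \<Rightarrow> 0 | Gc \<Rightarrow> 0 | Gd \<Rightarrow> 1 | Gi \<Rightarrow> 1"]
    by (simp_all add: GL_counit_def)
  then show "GL_counit \<in> alg_hom H complex_alg" "GL_counit (g Ga) = 1" "GL_counit (g Gb) = 0"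
    "GL_counit (g Gc) = 0" "GL_counit (g Gd) = 1" "GL_counit (g Gi) = 1"
    by simp_all
qed

text \<open>S belongs to the inverse matrix as a point of the opposite algebra. On generators the
  identities say that this matrix is a two-sided inverse; the remaining work is to carry them over
  to products.\<close>

lemma antipode_exists:
  "\<exists>S\<in>lin_hom H H. \<forall>x\<in>carrier H.
      tensor_lift H (\<lambda>y z. S y \<otimes>\<^bsub>H\<^esub> z) (GL_comult p q x) = GL_counit x \<odot>\<^bsub>H\<^esub> \<one>\<^bsub>H\<^esub> \<and>
      tensor_lift H (\<lambda>y z. y \<otimes>\<^bsub>H\<^esub> S z) (GL_comult p q x) = GL_counit x \<odot>\<^bsub>H\<^esub> \<one>\<^bsub>H\<^esub>"
proof -
  let ?Op = "H\<lparr>mult := \<lambda>x y. y \<otimes>\<^bsub>H\<^esub> x\<rparr>"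
  define v where "v = (\<lambda>x. case x of Ga \<Rightarrow> g Gd \<otimes>\<^bsub>H\<^esub> g Gi
    | Gb \<Rightarrow> (- p) \<odot>\<^bsub>H\<^esub> (g Gb \<otimes>\<^bsub>H\<^esub> g Gi) | Gc \<Rightarrow> (- (1 / p)) \<odot>\<^bsub>H\<^esub> (g Gc \<otimes>\<^bsub>H\<^esub> g Gi)
    | Gd \<Rightarrow> g Ga \<otimes>\<^bsub>H\<^esub> g Gi | Gi \<Rightarrow> g.det)"
  define S where "S = pres_lift ?Op v"
  have "\<forall>x. v x \<in> carrier ?Op"
    by (simp add: v_def split: gl_gen.split)
  moreover have "GL_tuple ?Op p q (v Ga) (v Gb) (v Gc) (v Gd) (v Gi)"
    using g.GL_tuple_opposite by (simp add: v_def)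
  ultimately have S: "S \<in> alg_hom H ?Op" "S (g x) = v x" for x
    unfolding S_def by (rule GL_lift[OF complex_algebra_opposite[OF H.complex_algebra_axioms]])+
  from S(1) have lin: "S \<in> lin_hom H H" and one: "S \<one>\<^bsub>H\<^esub> = \<one>\<^bsub>H\<^esub>"
    and anti: "\<And>x y. \<lbrakk>x \<in> carrier H; y \<in> carrier H\<rbrakk> \<Longrightarrow> S (x \<otimes>\<^bsub>H\<^esub> y) = S y \<otimes>\<^bsub>H\<^esub> S x"
    by (simp_all add: alg_hom_opposite_iff)
  note Sl = lin_homD[OF lin]
  have bl: "bilinear_map H H H (\<lambda>y z. S y \<otimes>\<^bsub>H\<^esub> z)" "bilinear_map H H H (\<lambda>y z. y \<otimes>\<^bsub>H\<^esub> S z)"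
    by (rule_tac [!] bilinear_mapI)
      (simp_all add: Sl H.l_distr H.r_distr H.smult_mult_left H.smult_mult_right)
  note L = lin_homD[OF gg.tensor_lift_lin_hom[OF H.complex_algebra_axioms bl(1)]]
    gg.tensor_lift_tensor[OF H.complex_algebra_axioms bl(1)]
  note R = lin_homD[OF gg.tensor_lift_lin_hom[OF H.complex_algebra_axioms bl(2)]]
    gg.tensor_lift_tensor[OF H.complex_algebra_axioms bl(2)]
  note conv = convolution_mult[OF H.complex_algebra_axioms lin anti]
  have "tensor_lift H (\<lambda>y z. S y \<otimes>\<^bsub>H\<^esub> z) (GL_comult p q x) = GL_counit x \<odot>\<^bsub>H\<^esub> \<one>\<^bsub>H\<^esub> \<and>
      tensor_lift H (\<lambda>y z. y \<otimes>\<^bsub>H\<^esub> S z) (GL_comult p q x) = GL_counit x \<odot>\<^bsub>H\<^esub> \<one>\<^bsub>H\<^esub>"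
    if "x \<in> carrier H" for x
    using that
  proof (induction x rule: GL_induct)
    case one
    then show ?case
      by (simp add: alg_hom_one[OF comult_hom] alg_hom_one[OF counit_hom] gg.tensor_one L R \<open>S \<one>\<^bsub>H\<^esub> = _\<close>)
  next
    case (gen x)
    have Sv: "S (g x) = v x" for x by (rule S(2))
    show ?case
      by (cases x) (simp_all add: comult_gen counit_gen L R Sv v_def g.antipode_rules)
  next
    case (add x y)
    then show ?case
      by (simp add: alg_homD[OF comult_hom] alg_homD[OF counit_hom] L R H.smult_add_left)
  next
    \<comment> \<open>For S convolved with the identity the scalar pulled out is the counit of x;
      for the opposite order it is the counit of y, and commutativity of the complex numbers
      reconciles the two.\<close>
    case (mult x y)
    then show ?case
      by (simp add: alg_homD[OF comult_hom] alg_homD[OF counit_hom] conv H.smult_smult mult.commute)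
  next
    case (smult s x)
    then show ?case
      by (simp add: alg_homD[OF comult_hom] alg_homD[OF counit_hom] L R H.smult_smult)
  qed
  with lin show ?thesis by blast
qed

text \<open>Coassociativity on the four matrix entries is associativity of matrix multiplication,
  and on \<open>Gi\<close> it is immediate because \<open>Gi\<close> is group-like. The counit
  axioms express that the identity matrix is neutral.\<close>

lemma hopf_algebra_GL: "hopf_algebra H (GL_comult p q) GL_counit"
proof (intro hopf_algebra.intro hopf_algebra_axioms.intro)
  show "complex_algebra H" by (rule H.complex_algebra_axioms)
  show "GL_comult p q \<in> alg_hom H HH" by (rule comult_hom)
  show "GL_counit \<in> alg_hom H complex_alg" by (rule counit_hom)
  show "\<exists>S\<in>lin_hom H H. \<forall>x\<in>carrier H.
      tensor_lift H (\<lambda>y z. S y \<otimes>\<^bsub>H\<^esub> z) (GL_comult p q x) = GL_counit x \<odot>\<^bsub>H\<^esub> \<one>\<^bsub>H\<^esub> \<and>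
      tensor_lift H (\<lambda>y z. y \<otimes>\<^bsub>H\<^esub> S z) (GL_comult p q x) = GL_counit x \<odot>\<^bsub>H\<^esub> \<one>\<^bsub>H\<^esub>"
    by (rule antipode_exists)
  fix x assume x: "x \<in> carrier H"
  note tp = gg.tensor_product_axioms HHH.AB_C.tensor_product_axioms HHH.A_BC.tensor_product_axioms
  note l = tensor_map_alg_hom[OF tp(1,2) comult_hom alg_hom_id[of H]]
  note r = tensor_map_alg_hom[OF tp(1,3) alg_hom_id[of H] comult_hom]
  note gens = comult_gen alg_homD[OF l] alg_homD[OF r] alg_homD[OF HHH.tensor_assoc_alg_hom]
    tensor_map_tensor[OF tp(1,2) alg_hom_lin[OF comult_hom] alg_hom_lin[OF alg_hom_id[of H]]]
    tensor_map_tensor[OF tp(1,3) alg_hom_lin[OF alg_hom_id[of H]] alg_hom_lin[OF comult_hom]]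
    HHH.AB_C.tensor_bilinear HHH.A_BC.tensor_bilinear HHH.tensor_assoc_tensor HHH.A_BC.T.a_ac
  show "tensor_assoc H H H (tensor_map HH H (GL_comult p q) (\<lambda>y. y) (GL_comult p q x))
      = tensor_map H HH (\<lambda>y. y) (GL_comult p q) (GL_comult p q x)"
  proof (rule GL_hom_eqI[OF _ _ _ x])
    show "(\<lambda>x. tensor_assoc H H H (tensor_map HH H (GL_comult p q) (\<lambda>y. y) (GL_comult p q x)))
        \<in> alg_hom H (tensor_alg H HH)"
      by (intro alg_hom_comp[OF _ HHH.tensor_assoc_alg_hom] alg_hom_comp[OF _ l] comult_hom)
    show "(\<lambda>x. tensor_map H HH (\<lambda>y. y) (GL_comult p q) (GL_comult p q x))
        \<in> alg_hom H (tensor_alg H HH)"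
      by (intro alg_hom_comp[OF _ r] comult_hom)
    show "tensor_assoc H H H (tensor_map HH H (GL_comult p q) (\<lambda>y. y) (GL_comult p q (g x)))
        = tensor_map H HH (\<lambda>y. y) (GL_comult p q) (GL_comult p q (g x))" for x
      by (cases x) (simp_all add: gens)
  qed
  note cl = counit_lift[OF H.complex_algebra_axioms H.complex_algebra_axioms counit_hom]
  note c = alg_homD[OF cl(1)] alg_homD[OF cl(3)] cl(2,4) comult_gen counit_gen
  show "tensor_lift H (\<lambda>y z. GL_counit y \<odot>\<^bsub>H\<^esub> z) (GL_comult p q x) = x"
    by (rule GL_hom_eqI[OF alg_hom_comp[OF comult_hom cl(1)] alg_hom_id _ x],
        case_tac x) (simp_all add: c)
  show "tensor_lift H (\<lambda>y z. GL_counit z \<odot>\<^bsub>H\<^esub> y) (GL_comult p q x) = x"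
    by (rule GL_hom_eqI[OF alg_hom_comp[OF comult_hom cl(3)] alg_hom_id _ x],
        case_tac x) (simp_all add: c)
qed

end

section \<open>The coaction\<close>

text \<open>A point of the cubic algebra, with its relations solved for the words y x x and y y x.
  The other six words of degree three are left alone.\<close>

locale AS_pair = complex_algebra A for A :: "(complex, 'a, 'm) module_scheme" (structure) +
  fixes q r :: complex and x y
  assumes closed [simp]: "x \<in> carrier A" "y \<in> carrier A"
    and yxx: "y \<otimes> (x \<otimes> x) = (q + r) \<odot> (x \<otimes> (y \<otimes> x)) \<oplus> (- (q * r)) \<odot> (x \<otimes> (x \<otimes> y))"
    and yyx: "y \<otimes> (y \<otimes> x) = (q + r) \<odot> (y \<otimes> (x \<otimes> y)) \<oplus> (- (q * r)) \<odot> (x \<otimes> (y \<otimes> y))"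

lemma AS_rels_iff:
  fixes A :: "(complex, 'a, 'm) module_scheme" (structure)
  assumes A: "complex_algebra A" and v: "\<forall>g. v g \<in> carrier A"
  shows "(\<forall>x\<in>AS_rels q r. lin_ext A (word_prod A v) x = \<zero>\<^bsub>A\<^esub>)
    \<longleftrightarrow> AS_pair A q r (v E1) (v E2)" (is "?L \<longleftrightarrow> ?R")
proof -
  interpret complex_algebra A by fact
  have [simp]: "v g \<in> carrier A" for g using v by simp
  note ev = word_eval_diff[OF v] word_eval_add[OF v] word_eval_single[OF v]
  note f = functional_simps functional_zero[OF A]
  show ?thesis
  proof
    assume L: ?L
    have E: "\<phi> (v E2 \<otimes> (v E1 \<otimes> v E1)) + q * r * \<phi> (v E1 \<otimes> (v E1 \<otimes> v E2))
        - (q + r) * \<phi> (v E1 \<otimes> (v E2 \<otimes> v E1)) = 0"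
      "\<phi> (v E2 \<otimes> (v E2 \<otimes> v E1)) + q * r * \<phi> (v E1 \<otimes> (v E2 \<otimes> v E2))
        - (q + r) * \<phi> (v E2 \<otimes> (v E1 \<otimes> v E2)) = 0"
      if \<phi>: "\<phi> \<in> lin_hom A complex_alg" for \<phi>
    proof -
      have "\<forall>x\<in>AS_rels q r. \<phi> (lin_ext A (word_prod A v) x) = 0"
        using L functional_zero[OF A \<phi>] by simp
      then show "\<phi> (v E2 \<otimes> (v E1 \<otimes> v E1)) + q * r * \<phi> (v E1 \<otimes> (v E1 \<otimes> v E2))
        - (q + r) * \<phi> (v E1 \<otimes> (v E2 \<otimes> v E1)) = 0"
      "\<phi> (v E2 \<otimes> (v E2 \<otimes> v E1)) + q * r * \<phi> (v E1 \<otimes> (v E2 \<otimes> v E2))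
        - (q + r) * \<phi> (v E2 \<otimes> (v E1 \<otimes> v E2)) = 0"
        by (auto simp: AS_rels_def Let_def ev functional_simps[OF \<phi>])
    qed
    show ?R
    proof (unfold_locales, goal_cases)
      case 3
      show ?case
        by (rule eq_functionalI) (use E(1) in \<open>auto simp: functional_simps algebra_simps\<close>)
    next
      case 4
      show ?case
        by (rule eq_functionalI) (use E(2) in \<open>auto simp: functional_simps algebra_simps\<close>)
    qed simp_all
  next
    assume ?R
    then interpret AS_pair A q r "v E1" "v E2" .
    show ?L
      unfolding AS_rels_def Let_def
      by (auto simp: ev intro!: eq_functionalI)
        (simp_all add: expand yxx yyx f algebra_simps)
  qed
qed

text \<open>A point of the quantum group carries points of the cubic algebra to points, as a matrix
  acts on a vector. Both relations are homogeneous of degree three, so after expansion the left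
  factors sort into ordered monomials and the right factors into the six remaining words. The
  coefficients agree because p = q / r^2, which is also the source of the second and fourth powers
  of r cleared at the end.\<close>

lemma AS_pair_tensor:
  assumes "GL_tuple A (q / r\<^sup>2) q a b c d i" "AS_pair B q r x y"
  shows "AS_pair (tensor_alg A B) q r
    (tensor A B a x \<oplus>\<^bsub>tensor_alg A B\<^esub> tensor A B b y) (tensor A B c x \<oplus>\<^bsub>tensor_alg A B\<^esub> tensor A B d y)"
proof -
  interpret A: GL_tuple A "q / r\<^sup>2" q a b c d i by fact
  interpret B: AS_pair B q r x y by fact
  interpret tensor_product A B by unfold_locales
  have [simp]: "r \<noteq> 0" "q \<noteq> 0" using A.pq by auto
  show ?thesis
  proof (unfold_locales, goal_cases)
    case 3
    show ?case
      by (rule T.eq_functionalI)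
       (simp_all add: A.normalize B.expand B.yxx B.yyx T.expand tensor_mult tensor_bilinear
         functional_simps, simp_all add: power2_eq_square power4_eq_xxxx field_simps)
  next
    case 4
    show ?case
      by (rule T.eq_functionalI)
       (simp_all add: A.normalize B.expand B.yxx B.yyx T.expand tensor_mult tensor_bilinear
         functional_simps, simp_all add: power2_eq_square power4_eq_xxxx field_simps)
  qed simp_all
qed

text \<open>The coaction belongs to the product of the universal matrix with the column of
  generators. Its coassociativity is (M N) v = M (N v), and its counit law is that the identity
  matrix fixes v; both are compared on the two generators.\<close>

lemma GL_acts_AS:
  assumes q: "q \<noteq> 0" and r: "r \<noteq> 0"
  shows "GL_acts (q / r\<^sup>2) q (AS_alg q r) (AS_gen q r E1) (AS_gen q r E2)"
proof -
  define p where "p = q / r\<^sup>2"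
  interpret GL_params p q using q r by unfold_locales (simp_all add: p_def)
  define A where "A = AS_alg q r"
  define e where "e = AS_gen q r"
  have A: "complex_algebra A"
    unfolding A_def AS_alg_def by (rule complex_algebra_pres_alg)
  have e [simp]: "e x \<in> carrier A" for x
    by (simp add: e_def A_def AS_gen_def AS_alg_def)
  interpret A: complex_algebra A by (rule A)
  have pair: "AS_pair A q r (e E1) (e E2)"
    unfolding AS_rels_iff[OF A, of e, simplified, symmetric]
    unfolding A_def e_def AS_gen_def AS_alg_def by (simp add: pres_rel)
  interpret HHA: tensor_triple H H A by unfold_locales
  let ?HA = "tensor_alg H A" and ?t = "tensor H A"
  define v where "v = (\<lambda>x. case x of
      E1 \<Rightarrow> ?t (g Ga) (e E1) \<oplus>\<^bsub>?HA\<^esub> ?t (g Gb) (e E2)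
    | E2 \<Rightarrow> ?t (g Gc) (e E1) \<oplus>\<^bsub>?HA\<^esub> ?t (g Gd) (e E2))"
  define \<delta> where "\<delta> = pres_lift ?HA v"
  have v: "\<forall>x. v x \<in> carrier ?HA"
    by (simp add: v_def split: as_gen.split)
  have rels: "\<forall>x\<in>AS_rels q r. lin_ext ?HA (word_prod ?HA v) x = \<zero>\<^bsub>?HA\<^esub>"
    unfolding AS_rels_iff[OF HHA.BC.T.complex_algebra_axioms v]
    using AS_pair_tensor[OF g.GL_tuple_axioms[unfolded p_def] pair] by (simp add: v_def p_def)
  have \<delta>: "\<delta> \<in> alg_hom A ?HA"
    unfolding \<delta>_def A_def AS_alg_def
    by (rule pres_lift_alg_hom[OF HHA.BC.T.complex_algebra_axioms v rels, unfolded A_def AS_alg_def])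
  have \<delta>_gen: "\<delta> (e x) = v x" for x
    unfolding \<delta>_def e_def AS_gen_def
    by (rule pres_lift_gen[OF HHA.BC.T.complex_algebra_axioms v rels])
  have eqI: "f x = h x" if "f \<in> alg_hom A B" "h \<in> alg_hom A B"
      "\<And>x. f (e x) = h (e x)" "x \<in> carrier A" for B :: "(complex, 'z, 'k) module_scheme" and f h x
    using that unfolding A_def e_def AS_alg_def AS_gen_def by (rule pres_hom_eqI)
  have "hopf_coaction H (GL_comult p q) GL_counit A \<delta>"
  proof (intro hopf_coaction.intro hopf_coaction_axioms.intro hopf_algebra_GL A \<delta>)
    fix x assume x: "x \<in> carrier A"
    note tp = HHA.BC.tensor_product_axioms HHA.AB_C.tensor_product_axioms HHA.A_BC.tensor_product_axioms
    note l = tensor_map_alg_hom[OF tp(1,2) comult_hom alg_hom_id[of A]]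
    note r = tensor_map_alg_hom[OF tp(1,3) alg_hom_id[of H] \<delta>]
    note gens = comult_gen \<delta>_gen v_def alg_homD[OF l] alg_homD[OF r] alg_homD[OF HHA.tensor_assoc_alg_hom]
      tensor_map_tensor[OF tp(1,2) alg_hom_lin[OF comult_hom] alg_hom_lin[OF alg_hom_id[of A]]]
      tensor_map_tensor[OF tp(1,3) alg_hom_lin[OF alg_hom_id[of H]] alg_hom_lin[OF \<delta>]]
      HHA.AB_C.tensor_bilinear HHA.A_BC.tensor_bilinear HHA.tensor_assoc_tensor HHA.A_BC.T.a_ac
    show "tensor_assoc H H A (tensor_map HH A (GL_comult p q) (\<lambda>y. y) (\<delta> x))
        = tensor_map H ?HA (\<lambda>y. y) \<delta> (\<delta> x)"
    proof (rule eqI[OF _ _ _ x])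
      show "(\<lambda>x. tensor_assoc H H A (tensor_map HH A (GL_comult p q) (\<lambda>y. y) (\<delta> x)))
          \<in> alg_hom A (tensor_alg H ?HA)"
        by (intro alg_hom_comp[OF _ HHA.tensor_assoc_alg_hom] alg_hom_comp[OF _ l] \<delta>)
      show "(\<lambda>x. tensor_map H ?HA (\<lambda>y. y) \<delta> (\<delta> x)) \<in> alg_hom A (tensor_alg H ?HA)"
        by (intro alg_hom_comp[OF _ r] \<delta>)
      show "tensor_assoc H H A (tensor_map HH A (GL_comult p q) (\<lambda>y. y) (\<delta> (e x)))
          = tensor_map H ?HA (\<lambda>y. y) \<delta> (\<delta> (e x))" for x
        by (cases x) (simp_all add: gens)
    qed
    note cl = counit_lift[OF H.complex_algebra_axioms A counit_hom]
    show "tensor_lift A (\<lambda>h y. GL_counit h \<odot>\<^bsub>A\<^esub> y) (\<delta> x) = x"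
      by (rule eqI[OF alg_hom_comp[OF \<delta> cl(1)] alg_hom_id _ x], case_tac x)
        (simp_all add: alg_homD[OF cl(1)] cl(2) \<delta>_gen v_def counit_gen)
  qed
  then show ?thesis
    unfolding GL_acts_def Let_def
    using \<delta>_gen[of E1] \<delta>_gen[of E2] by (auto simp: v_def p_def A_def e_def)
qed

lemma AS_rels_commute: "AS_rels q r = AS_rels r q"
  by (simp add: AS_rels_def mult.commute add.commute)

theorem mainTheorem3:
  fixes q r p :: complex
  assumes "q * r \<noteq> 0" and "p = q / r\<^sup>2"
  shows "GL_acts p q (AS_alg q r) (AS_gen q r E1) (AS_gen q r E2)
    \<and> AS_alg q r = AS_alg r q
    \<and> GL_acts (r / q\<^sup>2) r (AS_alg q r) (AS_gen q r E1) (AS_gen q r E2)"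
proof -
  have eq: "AS_alg q r = AS_alg r q" "AS_gen q r = AS_gen r q"
    using AS_rels_commute[of q r] by (simp_all add: AS_alg_def AS_gen_def)
  \<comment> \<open>The second action is the first with q and r exchanged, carried back along the
    equality of the algebras and of their generators.\<close>
  show ?thesis
    using assms GL_acts_AS[of q r] GL_acts_AS[of r q] by (simp add: eq[symmetric])
qed

end
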